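(* Let $k\ge 2$ and $n\ge 3k$ be integers. Every graph in $\mathcal{T}_{n,2k}$ is a connected graph on $n$ vertices with dissociation number $2k$, and it has the minimum number of edges among all connected graphs on $n$ vertices with dissociation number $2k$; this minimum equals $\binom{n}{2}-\mathrm{ex}(n,L_{2k+1})+k-1$.
   Context: For even $d$, $CP_d$ is the complement of a perfect matching in $K_d$; for odd $d$, $L_d=CP_{d-1}\vee K_1$. $\mathrm{ex}(n,F)$ is the maximum number of edges of an $n$-vertex graph with no subgraph isomorphic to $F$. The dissociation number of $G$ is the largest size of a vertex set inducing a subgraph of maximum degree at most $1$. The set $\mathcal{T}_{n,2k}$: choose integers $n_1,\dots,n_k\ge 3$ with $\sum n_i=n$ such that for all $i\ne j$, $|n_i-n_j|\le 2$, with $|n_i-n_j|=2$ only if both are even; take the disjoint union of graphs $C_1,\dots,C_k$ where $C_i=CP_{n_i}$ if $n_i$ is even and $C_i=L_{n_i}$ if $n_i$ is odd (equivalently, the complement of the graph obtained from $K_{n_1,\dots,n_k}$ by adding a maximum matching in each part); then add $k-1$ edges between distinct $C_i$'s so that the resulting graph is connected. $\mathcal{T}_{n,2k}$ is the set of all graphs so obtained. *)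

theory Defs
  imports Complex_Main
begin

datatype 'a ugraph = UGraph (verts: "'a set") (edges: "'a set set")

definition simple_graph :: "'a ugraph \<Rightarrow> bool" where
  "simple_graph G \<longleftrightarrow> finite (verts G) \<and> (\<forall>e \<in> edges G. e \<subseteq> verts G \<and> card e = 2)"

definition num_edges :: "'a ugraph \<Rightarrow> nat" where
  "num_edges G = card (edges G)"

definition degree :: "'a ugraph \<Rightarrow> 'a \<Rightarrow> nat" where
  "degree G v = card {e \<in> edges G. v \<in> e}"

definition connected_graph :: "'a ugraph \<Rightarrow> bool" where
  "connected_graph G \<longleftrightarrow> verts G \<noteq> {} \<and>
     (\<forall>u \<in> verts G. \<forall>v \<in> verts G. (u, v) \<in> {(x, y). {x, y} \<in> edges G}\<^sup>*)"

definition subgraph :: "'a ugraph \<Rightarrow> 'a ugraph \<Rightarrow> bool" where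
  "subgraph H G \<longleftrightarrow> simple_graph H \<and> verts H \<subseteq> verts G \<and> edges H \<subseteq> edges G"

definition induced :: "'a ugraph \<Rightarrow> 'a set \<Rightarrow> 'a ugraph" where
  "induced G S = UGraph S {e \<in> edges G. e \<subseteq> S}"

definition isomorphic :: "'a ugraph \<Rightarrow> 'b ugraph \<Rightarrow> bool" where
  "isomorphic G H \<longleftrightarrow>
     (\<exists>f. bij_betw f (verts G) (verts H) \<and> edges H = (\<lambda>e. f ` e) ` edges G)"

definition complete_graph :: "'a set \<Rightarrow> 'a ugraph" where
  "complete_graph S = UGraph S {e. e \<subseteq> S \<and> card e = 2}"

text \<open>Only used for graphs with disjoint vertex sets.\<close>
definition join :: "'a ugraph \<Rightarrow> 'a ugraph \<Rightarrow> 'a ugraph" where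
  "join G H = UGraph (verts G \<union> verts H)
     (edges G \<union> edges H \<union> {{u, v} | u v. u \<in> verts G \<and> v \<in> verts H})"

text \<open>Only meaningful for even \<open>d\<close>, where the removed edges \<open>{0,1}, {2,3}, \<dots>\<close> form a perfect
  matching of the complete graph on \<open>{..<d}\<close>.\<close>
definition CP :: "nat \<Rightarrow> nat ugraph" where
  "CP d = UGraph {..<d} (edges (complete_graph {..<d}) - {{2 * i, 2 * i + 1} | i. i < d div 2})"

text \<open>Only meaningful for odd \<open>d\<close>; the added vertex is \<open>d - 1\<close>.\<close>
definition L :: "nat \<Rightarrow> nat ugraph" where
  "L d = join (CP (d - 1)) (complete_graph {d - 1})"

text \<open>Every graph on \<open>n\<close> vertices is isomorphic to one with vertex set \<open>{..<n}\<close>, so it suffices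
  to maximise over those.\<close>
definition ex :: "nat \<Rightarrow> 'b ugraph \<Rightarrow> nat" where
  "ex n F = Max (num_edges ` {G :: nat ugraph. simple_graph G \<and> verts G = {..<n} \<and>
                               \<not> (\<exists>H. subgraph H G \<and> isomorphic H F)})"

definition dissociation_set :: "'a ugraph \<Rightarrow> 'a set \<Rightarrow> bool" where
  "dissociation_set G S \<longleftrightarrow> S \<subseteq> verts G \<and> (\<forall>v \<in> S. degree (induced G S) v \<le> 1)"

definition dissociation_number :: "'a ugraph \<Rightarrow> nat" where
  "dissociation_number G = Max (card ` {S. dissociation_set G S})"

definition connected_diss_graphs :: "nat \<Rightarrow> nat \<Rightarrow> 'a ugraph set" where
  "connected_diss_graphs n d = {G. simple_graph G \<and> connected_graph G \<and>
                                   card (verts G) = n \<and> dissociation_number G = d}"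

text \<open>\<open>T_family n k\<close> represents the set written T with index n, 2k; it is closed under isomorphism.
  The sizes \<open>n\<^sub>i\<close> are \<open>ns i\<close> for \<open>i < k\<close>, and \<open>F\<close> is the set of added edges.\<close>
definition T_family :: "nat \<Rightarrow> nat \<Rightarrow> 'a ugraph set" where
  "T_family n k = {G. \<exists>(ns :: nat \<Rightarrow> nat) (C :: nat \<Rightarrow> 'a ugraph) (F :: 'a set set).
     (\<forall>i<k. 3 \<le> ns i) \<and> (\<Sum>i<k. ns i) = n \<and>
     (\<forall>i<k. \<forall>j<k. i \<noteq> j \<longrightarrow>
        \<bar>int (ns i) - int (ns j)\<bar> \<le> 2 \<and>
        (\<bar>int (ns i) - int (ns j)\<bar> = 2 \<longrightarrow> even (ns i) \<and> even (ns j))) \<and>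
     (\<forall>i<k. simple_graph (C i) \<and> isomorphic (C i) (if even (ns i) then CP (ns i) else L (ns i))) \<and>
     (\<forall>i<k. \<forall>j<k. i \<noteq> j \<longrightarrow> verts (C i) \<inter> verts (C j) = {}) \<and>
     card F = k - 1 \<and> finite F \<and>
     (\<forall>e\<in>F. \<exists>i<k. \<exists>j<k. i \<noteq> j \<and> (\<exists>u \<in> verts (C i). \<exists>v \<in> verts (C j). e = {u, v})) \<and>
     G = UGraph (\<Union>i<k. verts (C i)) ((\<Union>i<k. edges (C i)) \<union> F) \<and>
     connected_graph G}"

end

theory Submission
  imports Defs
begin

text \<open>
  Write \<open>phi\<close> for the number of edges plus the number of components, and let \<open>D\<close> bound the size of the
  dissociation sets of a graph on \<open>n\<close> vertices. For every \<open>a \<ge> 1\<close> the linear inequality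
  \<open>4 a n \<le> 2 phi + D (2 a\<^sup>2 + 2 a - 1)\<close> holds. If all parts of a member of the family have sizes between
  \<open>2 a\<close> and \<open>2 a + 2\<close>, the inequality for this \<open>a\<close> and \<open>D = 2 k\<close> is tight, which gives minimality; read
  the other way round it also forces the dissociation number of the member up to \<open>2 k\<close>.

  The inequality is proved by induction on \<open>a\<close>. As in the partition theorem of Lovasz, a colouring with
  \<open>a\<close> colours minimising the monochromatic edges splits a graph of maximum degree below \<open>2 a\<close> into \<open>a\<close>
  dissociation sets, so that \<open>n \<le> a D\<close>, and then the inequality for \<open>a - 1\<close> is the stronger one. A vertex
  whose removal lowers \<open>phi\<close> by at least \<open>2 a\<close> can be removed. What remains are cut vertices of degree at
  least \<open>2 a\<close>, where the colourings of the branches may not fit together. Such a vertex is sacrificed, and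
  this is paid for by removing vertices at which \<open>phi\<close> drops by more than \<open>2 a - 2\<close>.

  The same argument without components bounds the number of edges of graphs that need not be connected.
  Since the complement of \<open>L (2 k + 1)\<close> is a matching and an isolated vertex, this evaluates \<open>ex\<close>.
\<close>

section \<open>Edges, components and cut vertices\<close>

text \<open>The coefficients come from the cocktail party graphs. As \<open>d\<close> runs through
  \<open>2 * a\<close>, \<open>2 * a + 1\<close>, \<open>2 * a + 2\<close>, the edge count of
  \<open>CP d\<close> is the linear function \<open>2 * a * d - 2 * a * (a + 1)\<close>. For
  \<open>d \<ge> 3\<close> such a graph is connected with dissociation number 2, and equality in the
  inequality dictates the factor \<open>2 * a * a + 2 * a - 1\<close>. Components are counted
  because an edge joining two components leaves \<open>phi\<close> unchanged, so linking the parts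
  into a tree is free. The obstacle is that the drop of \<open>phi\<close> at a vertex of a
  connected graph is its degree only if it is not a cut vertex; in general it is the degree minus
  the number of branches plus one. A cut vertex may thus be too cheap to remove and still have too
  many neighbours for the colouring. The induction step therefore works with two sets:
  \<open>S\<close>, deleted before the bound for the smaller \<open>a\<close> is applied, and
  \<open>T\<close>, left uncoloured. Their weights in \<open>solvable\<close> are those for which
  the step closes.\<close>

locale sgraph =
  fixes E :: "'a set set"
  assumes card_edge: "e \<in> E \<Longrightarrow> card e = 2"
begin

abbreviation adj :: "'a \<Rightarrow> 'a \<Rightarrow> bool" where
  "adj u v \<equiv> {u, v} \<in> E"

lemma adj_irrefl [simp]: "{v} \<notin> E"
  using card_edge[of "{v}"] by auto

lemma adj_sym: "adj u v \<Longrightarrow> adj v u"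
  by (simp add: insert_commute)

definition cdeg :: "'a set \<Rightarrow> ('a \<Rightarrow> nat) \<Rightarrow> 'a \<Rightarrow> nat \<Rightarrow> nat" where
  "cdeg V \<kappa> v c = card {u \<in> V. adj v u \<and> \<kappa> u = c}"

definition deg :: "'a set \<Rightarrow> 'a \<Rightarrow> nat" where
  "deg V v = card {u \<in> V. adj v u}"

definition mono_edges :: "'a set \<Rightarrow> ('a \<Rightarrow> nat) \<Rightarrow> nat" where
  "mono_edges V \<kappa> = card {e \<in> E. e \<subseteq> V \<and> (\<forall>x\<in>e. \<forall>y\<in>e. \<kappa> x = \<kappa> y)}"

definition edge_count :: "'a set \<Rightarrow> nat" where
  "edge_count V = card {e \<in> E. e \<subseteq> V}"

text \<open>An edge inside \<open>insert v V\<close> either lies in \<open>V\<close> or is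
  determined by its end other than \<open>v\<close>; an edge of the second kind is monochromatic
  exactly if that end has the colour of \<open>v\<close>.\<close>

lemma mono_edges_insert:
  assumes "finite V" "v \<notin> V"
  shows "mono_edges (insert v V) \<kappa> = mono_edges V \<kappa> + cdeg V \<kappa> v (\<kappa> v)"
proof -
  let ?A = "{e \<in> E. e \<subseteq> V \<and> (\<forall>x\<in>e. \<forall>y\<in>e. \<kappa> x = \<kappa> y)}"
  let ?N = "{u \<in> V. adj v u \<and> \<kappa> u = \<kappa> v}"
  have "{e \<in> E. e \<subseteq> insert v V \<and> (\<forall>x\<in>e. \<forall>y\<in>e. \<kappa> x = \<kappa> y)} = ?A \<union> (\<lambda>u. {v, u}) ` ?N"
    (is "?L = ?R")
  proof
    show "?L \<subseteq> ?R"
    proof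
      fix e assume e: "e \<in> ?L"
      show "e \<in> ?R"
      proof (cases "v \<in> e")
        case True
        obtain x y where "e = {x, y}" "x \<noteq> y"
          using e card_edge[of e] by (auto simp: card_2_iff)
        then obtain u where u: "e = {v, u}" "u \<noteq> v"
          using True by auto
        then have "u \<in> ?N" using e by blast
        then show ?thesis using u by blast
      next
        case False
        then show ?thesis using e by blast
      qed
    qed
    show "?R \<subseteq> ?L" by fastforce
  qed
  moreover have "?A \<inter> (\<lambda>u. {v, u}) ` ?N = {}"
    using assms by auto
  moreover have "finite ?A"
    by (rule finite_subset[of _ "Pow V"]) (use assms in auto)
  moreover have "card ((\<lambda>u. {v, u}) ` ?N) = card ?N"
    by (rule card_image) (auto simp: inj_on_def doubleton_eq_iff)
  ultimately show ?thesis
    unfolding mono_edges_def cdeg_def using assms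
    by (simp add: card_Un_disjoint)
qed

text \<open>Under a constant colouring every edge is monochromatic, so facts about coloured counts
  specialise to plain edge counts and degrees.\<close>

lemma edge_count_mono_edges: "edge_count V = mono_edges V (\<lambda>_. 0)"
  by (simp add: edge_count_def mono_edges_def)

lemma deg_cdeg: "deg V v = cdeg V (\<lambda>_. 0) v 0"
  by (simp add: deg_def cdeg_def)

lemma edge_count_insert:
  assumes "finite V" "v \<notin> V"
  shows "edge_count (insert v V) = edge_count V + deg V v"
  using mono_edges_insert[OF assms, of "\<lambda>_. 0"] by (simp add: edge_count_mono_edges deg_cdeg)

lemma edge_count_empty [simp]: "edge_count {} = 0"
  using card_edge by (force simp: edge_count_def)

lemma edge_count_union:
  assumes "finite A" "finite B" "A \<inter> B = {}" "\<forall>u\<in>A. \<forall>v\<in>B. \<not> adj u v"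
  shows "edge_count (A \<union> B) = edge_count A + edge_count B"
  using assms(2,3,4)
proof (induction B)
  case empty
  then show ?case by simp
next
  case (insert b B)
  have "{u \<in> A \<union> B. adj b u} = {u \<in> B. adj b u}"
    using insert.prems adj_sym by blast
  then have "deg (A \<union> B) b = deg B b" by (simp add: deg_def)
  then show ?case
    using insert edge_count_insert[of "A \<union> B" b] edge_count_insert[of B b] assms(1) by auto
qed

lemma deg_mono: "finite V \<Longrightarrow> U \<subseteq> V \<Longrightarrow> deg U v \<le> deg V v"
  unfolding deg_def by (rule card_mono) auto

lemma deg_remove_self: "deg (V - {v}) v = deg V v"
  unfolding deg_def by (rule arg_cong[of _ _ card]) auto

lemma deg_insert_self: "deg (insert v V) v = deg V v"
  unfolding deg_def by (rule arg_cong[of _ _ card]) auto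

lemma sum_cdeg:
  assumes "finite V" "\<forall>u\<in>V. \<kappa> u < a"
  shows "(\<Sum>c<a. cdeg V \<kappa> v c) = deg V v"
proof -
  have "{u \<in> V. adj v u} = (\<Union>c<a. {u \<in> V. adj v u \<and> \<kappa> u = c})"
    using assms by auto
  then have "deg V v = card (\<Union>c<a. {u \<in> V. adj v u \<and> \<kappa> u = c})"
    unfolding deg_def by simp
  also have "\<dots> = (\<Sum>c<a. cdeg V \<kappa> v c)"
    unfolding cdeg_def using assms(1) by (subst card_UN_disjoint) auto
  finally show ?thesis by simp
qed

lemma mono_edges_cong:
  assumes "\<And>v. v \<in> V \<Longrightarrow> \<kappa> v = \<kappa>' v"
  shows "mono_edges V \<kappa> = mono_edges V \<kappa>'"
proof -
  have "(\<forall>x\<in>e. \<forall>y\<in>e. \<kappa> x = \<kappa> y) \<longleftrightarrow> (\<forall>x\<in>e. \<forall>y\<in>e. \<kappa>' x = \<kappa>' y)"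
    if "e \<subseteq> V" for e
    by (intro ball_cong refl) (use assms that in \<open>simp add: subset_iff\<close>)
  then show ?thesis
    unfolding mono_edges_def by (metis (no_types, lifting))
qed

text \<open>Deleting \<open>v\<close> and putting it back with its new colour changes only the term
  contributed by \<open>v\<close>. Both sides are sums, which avoids truncated subtraction.\<close>

lemma mono_edges_recolour:
  assumes "finite V" "v \<in> V"
  shows "mono_edges V (\<kappa>(v := c)) + cdeg V \<kappa> v (\<kappa> v) = mono_edges V \<kappa> + cdeg V \<kappa> v c"
proof -
  let ?W = "V - {v}"
  have V: "V = insert v ?W" using assms by auto
  have self: "cdeg V \<kappa>' v c' = cdeg ?W \<kappa>' v c'" for \<kappa>' c'
    unfolding cdeg_def by (rule arg_cong[of _ _ card]) auto
  have "cdeg ?W (\<kappa>(v := c)) v c = cdeg ?W \<kappa> v c"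
    unfolding cdeg_def by (rule arg_cong[of _ _ card]) auto
  moreover have "mono_edges ?W (\<kappa>(v := c)) = mono_edges ?W \<kappa>"
    by (rule mono_edges_cong) auto
  ultimately show ?thesis
    using mono_edges_insert[of ?W v \<kappa>] mono_edges_insert[of ?W v "\<kappa>(v := c)"] assms V
    by (simp add: self insert_absorb)
qed

section \<open>Closed vertex sets, connectivity and components\<close>

definition sep :: "'a set \<Rightarrow> 'a set \<Rightarrow> bool" where
  "sep V X \<longleftrightarrow> X \<subseteq> V \<and> (\<forall>u\<in>X. \<forall>v\<in>V - X. \<not> adj u v)"

text \<open>Connectivity is phrased through closed sets instead of paths, so that restriction
  (\<open>sep_Int\<close>), nesting (\<open>sep_trans\<close>) and complements
  (\<open>sep_compl\<close>) are plain set algebra.\<close>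

definition conn :: "'a set \<Rightarrow> bool" where
  "conn V \<longleftrightarrow> V \<noteq> {} \<and> (\<forall>X. sep V X \<longrightarrow> X = {} \<or> X = V)"

definition comps :: "'a set \<Rightarrow> 'a set set" where
  "comps V = {C. sep V C \<and> conn C}"

lemma sep_compl: "sep V X \<Longrightarrow> sep V (V - X)"
  unfolding sep_def using adj_sym by blast

lemma sep_trans: "sep V X \<Longrightarrow> sep X Y \<Longrightarrow> sep V Y"
  unfolding sep_def by blast

lemma sep_Int: "sep V X \<Longrightarrow> U \<subseteq> V \<Longrightarrow> sep U (X \<inter> U)"
  unfolding sep_def by blast

lemma sepD: "sep V X \<Longrightarrow> u \<in> X \<Longrightarrow> v \<in> V \<Longrightarrow> adj u v \<Longrightarrow> v \<in> X"
  unfolding sep_def by blast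

lemma connD: "conn V \<Longrightarrow> sep V X \<Longrightarrow> X = {} \<or> X = V"
  unfolding conn_def by blast

lemma conn_sep: "conn C \<Longrightarrow> C \<subseteq> V \<Longrightarrow> sep V X \<Longrightarrow> C \<subseteq> X \<or> C \<inter> X = {}"
  using connD[of C "X \<inter> C"] sep_Int by blast

lemma comps_finite: "finite V \<Longrightarrow> finite (comps V)"
  by (rule finite_subset[of _ "Pow V"]) (auto simp: comps_def sep_def)

lemma comps_disjoint: "C \<in> comps V \<Longrightarrow> D \<in> comps V \<Longrightarrow> C \<noteq> D \<Longrightarrow> C \<inter> D = {}"
  using conn_sep[of C V D] conn_sep[of D V C] unfolding comps_def by (auto simp: sep_def)

text \<open>A smallest closed set containing \<open>v\<close> is connected: if it had a nonempty
  proper closed part, this part or its complement would be a smaller closed set containing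
  \<open>v\<close>.\<close>

lemma comps_cover:
  assumes "finite V" "v \<in> V"
  obtains C where "C \<in> comps V" "v \<in> C"
proof -
  let ?P = "\<lambda>C. sep V C \<and> v \<in> C"
  have "?P V" using assms by (auto simp: sep_def)
  then obtain C where C: "?P C" and min: "\<And>D. ?P D \<Longrightarrow> card C \<le> card D"
    using ex_has_least_nat[of ?P V card] by blast
  have fC: "finite C" using C assms by (auto simp: sep_def intro: finite_subset)
  have "X = {} \<or> X = C" if X: "sep C X" for X
  proof -
    have "sep V X" "sep V (C - X)" using sep_trans C X sep_compl by blast+
    moreover have "X \<subseteq> C" using X by (auto simp: sep_def)
    moreover have "v \<in> X \<or> v \<in> C - X" using C by blast
    ultimately have "card C \<le> card X \<or> card C \<le> card (C - X)" using min by blast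
    then show ?thesis
      using \<open>X \<subseteq> C\<close> fC by (metis Diff_subset card_seteq double_diff Diff_cancel order_refl)
  qed
  then have "conn C" using C by (auto simp: conn_def)
  then show thesis using that C by (auto simp: comps_def)
qed

lemma comps_conn: "conn V \<Longrightarrow> comps V = {V}"
  unfolding comps_def by (auto simp: conn_def) (auto simp: sep_def)

lemma comps_empty [simp]: "comps {} = {}"
  by (auto simp: comps_def sep_def conn_def)

lemma comps_sep:
  assumes "sep V A"
  shows "comps V = comps A \<union> comps (V - A)" "comps A \<inter> comps (V - A) = {}"
proof -
  have "C \<in> comps A \<union> comps (V - A)" if C: "C \<in> comps V" for C
  proof -
    have s: "sep V C" "conn C" "C \<subseteq> V" using C by (auto simp: comps_def sep_def)
    then have "C \<subseteq> A \<or> C \<inter> A = {}" using conn_sep assms by blast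
    then show ?thesis
    proof
      assume "C \<subseteq> A"
      then have "sep A C" using s assms unfolding sep_def by blast
      then show ?thesis using s by (simp add: comps_def)
    next
      assume "C \<inter> A = {}"
      then have "sep (V - A) C" using s assms unfolding sep_def by blast
      then show ?thesis using s by (simp add: comps_def)
    qed
  qed
  moreover have "comps A \<union> comps (V - A) \<subseteq> comps V"
    using sep_trans[OF assms] sep_trans[OF sep_compl[OF assms]] by (auto simp: comps_def)
  ultimately show "comps V = comps A \<union> comps (V - A)" by blast
  have "C = {}" if "C \<in> comps A" "C \<in> comps (V - A)" for C
    using that by (auto simp: comps_def sep_def)
  then show "comps A \<inter> comps (V - A) = {}"
    by (auto simp: comps_def conn_def)
qed

definition touched :: "'a set \<Rightarrow> 'a \<Rightarrow> 'a set set" where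
  "touched V p = {C \<in> comps V. \<exists>u\<in>C. adj p u}"

text \<open>A closed subset of the fused set that contains \<open>p\<close> absorbs each touched
  component through a neighbour of \<open>p\<close>, so the fused set is connected. Untouched
  components stay closed because \<open>p\<close> has no neighbour in them.\<close>

lemma comps_insert:
  assumes fin: "finite V" and p: "p \<notin> V"
  shows "comps (insert p V) = insert (insert p (\<Union>(touched V p))) (comps V - touched V p)"
proof -
  let ?K = "insert p (\<Union>(touched V p))"
  have sub: "C \<subseteq> V" "sep V C" "conn C" if "C \<in> comps V" for C
    using that by (auto simp: comps_def sep_def)
  have tc: "touched V p \<subseteq> comps V" by (auto simp: touched_def)
  have U: "\<Union>(touched V p) \<subseteq> V" using sub tc by blast
  have sepK: "sep (insert p V) ?K"
    unfolding sep_def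
  proof (intro conjI ballI)
    show "?K \<subseteq> insert p V" using U by auto
    fix u v assume u: "u \<in> ?K" and v: "v \<in> insert p V - ?K"
    then have vV: "v \<in> V" by auto
    show "\<not> adj u v"
    proof
      assume uv: "adj u v"
      show False
      proof (cases "u = p")
        case True
        obtain C where "C \<in> comps V" "v \<in> C" using comps_cover[OF fin vV] .
        then have "C \<in> touched V p" using uv True by (auto simp: touched_def)
        then show False using \<open>v \<in> C\<close> v by auto
      next
        case False
        then obtain C where C: "C \<in> touched V p" "u \<in> C" using u by auto
        then have "v \<in> C" using sepD[OF sub(2), of C u v] tc uv vV by blast
        then show False using C v by auto
      qed
    qed
  qed
  have "conn ?K"
    unfolding conn_def
  proof (intro conjI allI impI)
    fix X assume X: "sep ?K X"
    \<comment> \<open>Only closed sets containing \<open>p\<close> need an argument; the others are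
      treated through their complement.\<close>
    have all: "Y = ?K" if Y: "sep ?K Y" and pY: "p \<in> Y" for Y
    proof -
      have "C \<subseteq> Y" if C: "C \<in> touched V p" for C
      proof -
        obtain u where u: "u \<in> C" "adj p u" using C by (auto simp: touched_def)
        then have "u \<in> Y" using sepD[OF Y pY] C by blast
        then show ?thesis using conn_sep[of C ?K Y] sub(3) tc C u Y by blast
      qed
      then show ?thesis using Y pY unfolding sep_def by blast
    qed
    show "X = {} \<or> X = ?K"
    proof (cases "p \<in> X")
      case True then show ?thesis using all X by blast
    next
      case False
      then have "?K - X = ?K" using all[OF sep_compl[OF X]] by blast
      then show ?thesis using X unfolding sep_def by blast
    qed
  qed simp
  with sepK have K: "?K \<in> comps (insert p V)" by (simp add: comps_def)
  have un: "C \<in> comps (insert p V)" if C: "C \<in> comps V - touched V p" for C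
  proof -
    have "sep (insert p V) C"
      using sub[of C] C adj_sym unfolding sep_def touched_def by blast
    then show ?thesis using sub(3)[of C] C by (simp add: comps_def)
  qed
  have "C \<in> insert ?K (comps V - touched V p)" if C: "C \<in> comps (insert p V)" for C
  proof (cases "p \<in> C")
    case True
    then have "C = ?K" using comps_disjoint[OF C K] by auto
    then show ?thesis by simp
  next
    case False
    then have "C \<subseteq> V" "sep V C" "conn C" "\<forall>u\<in>C. \<not> adj p u"
      using C adj_sym unfolding comps_def sep_def by blast+
    then show ?thesis by (auto simp: comps_def touched_def)
  qed
  then show ?thesis using K un by blast
qed

section \<open>The potential \<open>phi\<close> and its drop at a vertex\<close>

definition phi :: "'a set \<Rightarrow> nat" where
  "phi V = edge_count V + card (comps V)"

lemma phi_empty [simp]: "phi {} = 0"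
  by (simp add: phi_def)

lemma phi_insert:
  assumes "finite V" "p \<notin> V"
  shows "phi (insert p V) + card (touched V p) = phi V + deg V p + 1"
proof -
  have fin: "finite (comps V)" using comps_finite assms by blast
  have tc: "touched V p \<subseteq> comps V" by (auto simp: touched_def)
  have "insert p (\<Union>(touched V p)) \<notin> comps V - touched V p"
    using assms(2) by (auto simp: comps_def sep_def)
  then have "card (comps (insert p V)) = Suc (card (comps V - touched V p))"
    using comps_insert[OF assms] fin by simp
  moreover have "card (comps V - touched V p) + card (touched V p) = card (comps V)"
    using tc fin by (metis card_Diff_subset card_mono finite_subset le_add_diff_inverse2)
  ultimately show ?thesis
    unfolding phi_def using edge_count_insert[OF assms] by simp
qed

text \<open>Choosing one neighbour of \<open>p\<close> in each touched component is injective,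
  because components are disjoint.\<close>

lemma touched_le_deg:
  assumes "finite V"
  shows "card (touched V p) \<le> deg V p"
proof -
  have "\<forall>C\<in>touched V p. \<exists>u. u \<in> C \<and> adj p u" by (auto simp: touched_def)
  then obtain f where f: "\<And>C. C \<in> touched V p \<Longrightarrow> f C \<in> C \<and> adj p (f C)"
    by metis
  have "inj_on f (touched V p)"
  proof (rule inj_onI)
    fix C D assume *: "C \<in> touched V p" "D \<in> touched V p" "f C = f D"
    then have "f C \<in> C \<inter> D" using f[OF *(1)] f[OF *(2)] by simp
    then show "C = D" using comps_disjoint[of C V D] * by (auto simp: touched_def)
  qed
  moreover have "f C \<in> {u \<in> V. adj p u}" if "C \<in> touched V p" for C
  proof -
    have "C \<subseteq> V" using that by (simp add: touched_def comps_def sep_def)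
    then show ?thesis using f[OF that] by blast
  qed
  then have "f ` touched V p \<subseteq> {u \<in> V. adj p u}" by blast
  ultimately show ?thesis
    unfolding deg_def using assms by (intro card_inj_on_le[where f = f]) auto
qed

lemma phi_insert_ge: "finite V \<Longrightarrow> p \<notin> V \<Longrightarrow> phi V + 1 \<le> phi (insert p V)"
  using phi_insert[of V p] touched_le_deg[of V p] by simp

lemma phi_Diff_ge:
  assumes "finite V" "X \<subseteq> V"
  shows "phi (V - X) + card X \<le> phi V"
proof -
  have "finite X" using assms finite_subset by blast
  then show ?thesis using assms(2)
  proof (induction X)
    case empty then show ?case by simp
  next
    case (insert x X)
    have "insert x (V - insert x X) = V - X" using insert by auto
    then have "phi (V - insert x X) + 1 \<le> phi (V - X)"
      using phi_insert_ge[of "V - insert x X" x] assms by auto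
    then show ?case using insert by simp
  qed
qed

lemma phi_sep:
  assumes "finite V" "sep V A"
  shows "phi V = phi A + phi (V - A)"
proof -
  have "A \<subseteq> V" and na: "\<forall>u\<in>A. \<forall>v\<in>V - A. \<not> adj u v" using assms by (auto simp: sep_def)
  then have f: "finite A" "finite (V - A)" "A \<union> (V - A) = V"
    using assms finite_subset by auto
  have "edge_count V = edge_count A + edge_count (V - A)"
    using edge_count_union[OF f(1,2) _ na] f(3) by auto
  moreover have "card (comps V) = card (comps A) + card (comps (V - A))"
    using comps_sep[OF assms(2)] comps_finite f by (simp add: card_Un_disjoint)
  ultimately show ?thesis by (simp add: phi_def)
qed

lemma deg_sep:
  assumes "finite V" "sep V A"
  shows "deg V p = deg A p + deg (V - A) p"
proof -
  have "{u \<in> V. adj p u} = {u \<in> A. adj p u} \<union> {u \<in> V - A. adj p u}"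
    using assms by (auto simp: sep_def)
  moreover have "finite A" using assms by (auto simp: sep_def intro: finite_subset)
  ultimately show ?thesis
    unfolding deg_def using assms(1) by (simp only:) (subst card_Un_disjoint, auto)
qed

lemma touched_sep:
  assumes "finite V" "sep V A"
  shows "card (touched V p) = card (touched A p) + card (touched (V - A) p)"
proof -
  have "touched V p = touched A p \<union> touched (V - A) p"
    using comps_sep(1)[OF assms(2)] by (auto simp: touched_def)
  moreover have "touched A p \<inter> touched (V - A) p = {}"
    using comps_sep(2)[OF assms(2)] by (auto simp: touched_def)
  moreover have "finite A" using assms by (auto simp: sep_def intro: finite_subset)
  ultimately show ?thesis
    using assms(1) comps_finite[of A] comps_finite[of "V - A"]
    by (simp add: card_Un_disjoint touched_def)
qed

text \<open>Degrees and touched components add up over the two sides; the surplus 1 arises because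
  \<open>p\<close> is counted on both of them.\<close>

lemma phi_cut_vertex:
  assumes "finite V" "p \<notin> V" "sep V A"
  shows "phi (insert p V) + 1 = phi (insert p A) + phi (insert p (V - A))"
proof -
  have "finite A" "p \<notin> A" using assms by (auto simp: sep_def intro: finite_subset)
  then show ?thesis
    using phi_insert[of V p] phi_insert[of A p] phi_insert[of "V - A" p] assms
      phi_sep[of V A] deg_sep[of V A p] touched_sep[of V A p]
    by simp
qed

lemma phi_insert_conn:
  assumes "finite C" "conn C" "p \<notin> C" "\<exists>u\<in>C. adj p u"
  shows "phi (insert p C) = phi C + deg C p"
proof -
  have "touched C p = {C}" using comps_conn[OF assms(2)] assms(4) by (auto simp: touched_def)
  then show ?thesis using phi_insert[of C p] assms by simp
qed

text \<open>This turns bounds on drops of \<open>phi\<close> into the degree bounds that the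
  colouring argument needs. The vertex has a neighbour, since otherwise the nonempty set
  \<open>V - {v}\<close> would be closed in \<open>V\<close>, and so exactly one component is
  touched.\<close>

lemma phi_remove_conn:
  assumes "finite V" "conn V" "v \<in> V" "conn (V - {v})"
  shows "phi V = phi (V - {v}) + deg V v"
proof -
  have "\<exists>u\<in>V - {v}. adj v u"
  proof (rule ccontr)
    assume "\<not> ?thesis"
    then have "sep V (V - {v})" using adj_sym unfolding sep_def by blast
    then show False using connD[OF assms(2)] assms(3,4) by (auto simp: conn_def)
  qed
  then show ?thesis
    using phi_insert_conn[of "V - {v}" v] assms by (simp add: insert_absorb deg_remove_self)
qed

section \<open>Colourings with few monochromatic edges\<close>

text \<open>The set \<open>Z\<close> marks vertices that must be isolated in their colour class. It
  exists for gluing: a cut vertex may have its one neighbour of the same colour on one side only, so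
  on the other side it has to be isolated.\<close>

definition defective :: "nat \<Rightarrow> 'a set \<Rightarrow> 'a set \<Rightarrow> ('a \<Rightarrow> nat) \<Rightarrow> bool" where
  "defective a V Z \<kappa> \<longleftrightarrow>
     (\<forall>v\<in>V. \<kappa> v < a \<and> cdeg V \<kappa> v (\<kappa> v) \<le> (if v \<in> Z then 0 else 1))"

definition optimal :: "nat \<Rightarrow> 'a set \<Rightarrow> ('a \<Rightarrow> nat) \<Rightarrow> bool" where
  "optimal a V \<kappa> \<longleftrightarrow> (\<forall>v\<in>V. \<kappa> v < a) \<and>
     (\<forall>\<kappa>'. (\<forall>v\<in>V. \<kappa>' v < a) \<longrightarrow> mono_edges V \<kappa> \<le> mono_edges V \<kappa>')"

lemma optimal_exists:
  assumes "0 < a"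
  obtains \<kappa> where "optimal a V \<kappa>"
proof -
  have "\<forall>v\<in>V. (\<lambda>_. 0) v < a" using assms by simp
  then show thesis
    using that ex_has_least_nat[of "\<lambda>\<kappa>. \<forall>v\<in>V. \<kappa> v < a" "\<lambda>_. 0" "mono_edges V"]
    unfolding optimal_def by blast
qed

lemma optimal_le:
  assumes "finite V" "optimal a V \<kappa>" "v \<in> V" "c < a"
  shows "cdeg V \<kappa> v (\<kappa> v) \<le> cdeg V \<kappa> v c"
proof -
  have "mono_edges V \<kappa> \<le> mono_edges V (\<kappa>(v := c))"
    using assms(2,4) by (simp add: optimal_def)
  then show ?thesis using mono_edges_recolour[OF assms(1,3), of \<kappa> c] by simp
qed

text \<open>By \<open>optimal_le\<close> no colour is rarer among the neighbours of \<open>v\<close>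
  than its own, so the claim follows by averaging over the \<open>a\<close> colours.\<close>

lemma optimal_mult_le:
  assumes "finite V" "optimal a V \<kappa>" "v \<in> V"
  shows "a * cdeg V \<kappa> v (\<kappa> v) \<le> deg V v"
proof -
  have "a * cdeg V \<kappa> v (\<kappa> v) = (\<Sum>c<a. cdeg V \<kappa> v (\<kappa> v))" by simp
  also have "\<dots> \<le> (\<Sum>c<a. cdeg V \<kappa> v c)"
    by (rule sum_mono) (use optimal_le[OF assms] in simp)
  also have "\<dots> = deg V v"
    using assms by (intro sum_cdeg) (auto simp: optimal_def)
  finally show ?thesis .
qed

lemma optimal_le_1:
  assumes "finite V" "optimal a V \<kappa>" "v \<in> V" "deg V v < 2 * a"
  shows "cdeg V \<kappa> v (\<kappa> v) \<le> 1"
proof (rule ccontr)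
  assume "\<not> ?thesis"
  then have "a * 2 \<le> a * cdeg V \<kappa> v (\<kappa> v)" by (intro mult_left_mono) auto
  then show False using optimal_mult_le[OF assms(1-3)] assms(4) by linarith
qed

lemma optimal_eq_0:
  assumes "finite V" "optimal a V \<kappa>" "v \<in> V" "deg V v < a"
  shows "cdeg V \<kappa> v (\<kappa> v) = 0"
proof (rule ccontr)
  assume "\<not> ?thesis"
  then have "a * 1 \<le> a * cdeg V \<kappa> v (\<kappa> v)" by (intro mult_left_mono) auto
  then show False using optimal_mult_le[OF assms(1-3)] assms(4) by linarith
qed

lemma optimal_defective:
  assumes "finite V" "optimal a V \<kappa>"
    and "\<And>v. v \<in> V \<Longrightarrow> deg V v < (if v \<in> Z then a else 2 * a)"
  shows "defective a V Z \<kappa>"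
  unfolding defective_def
proof
  fix v assume v: "v \<in> V"
  have "\<kappa> v < a" using assms(2) v by (simp add: optimal_def)
  moreover have "cdeg V \<kappa> v (\<kappa> v) \<le> (if v \<in> Z then 0 else 1)"
    using assms(3)[OF v] optimal_le_1[OF assms(1,2) v] optimal_eq_0[OF assms(1,2) v]
    by (simp split: if_splits)
  ultimately show "\<kappa> v < a \<and> cdeg V \<kappa> v (\<kappa> v) \<le> (if v \<in> Z then 0 else 1)" ..
qed

section \<open>Dissociation sets and the bound on edges alone\<close>

definition dissoc :: "'a set \<Rightarrow> bool" where
  "dissoc W \<longleftrightarrow> (\<forall>v\<in>W. deg W v \<le> 1)"

definition diss_bounded :: "'a set \<Rightarrow> nat \<Rightarrow> bool" where
  "diss_bounded V D \<longleftrightarrow> (\<forall>W\<subseteq>V. dissoc W \<longrightarrow> card W \<le> D)"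

lemma diss_bounded_subset: "diss_bounded V D \<Longrightarrow> U \<subseteq> V \<Longrightarrow> diss_bounded U D"
  unfolding diss_bounded_def by blast

text \<open>Each of the \<open>a\<close> colour classes induces maximum degree at most one, hence
  has at most \<open>D\<close> vertices.\<close>

lemma defective_card:
  assumes "finite V" "defective a V Z \<kappa>" "diss_bounded V D"
  shows "card V \<le> a * D"
proof -
  have "card {v \<in> V. \<kappa> v = c} \<le> D" for c
  proof -
    have "deg {v \<in> V. \<kappa> v = c} u \<le> 1" if "u \<in> V" "\<kappa> u = c" for u
    proof -
      have "deg {v \<in> V. \<kappa> v = c} u = cdeg V \<kappa> u (\<kappa> u)"
        unfolding deg_def cdeg_def using that by (intro arg_cong[of _ _ card]) auto
      also have "\<dots> \<le> (if u \<in> Z then 0 else 1)" using assms(2) that by (auto simp: defective_def)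
      also have "\<dots> \<le> 1" by simp
      finally show ?thesis .
    qed
    then have "dissoc {v \<in> V. \<kappa> v = c}" by (simp add: dissoc_def)
    then show ?thesis using assms(3) by (simp add: diss_bounded_def)
  qed
  then have "(\<Sum>c<a. card {v \<in> V. \<kappa> v = c}) \<le> (\<Sum>c<a. D)" by (intro sum_mono)
  moreover have "card V = (\<Sum>c<a. card {v \<in> V. \<kappa> v = c})"
  proof -
    have "V = (\<Union>c<a. {v \<in> V. \<kappa> v = c})" using assms(2) by (auto simp: defective_def)
    then have "card V = card (\<Union>c<a. {v \<in> V. \<kappa> v = c})" by simp
    also have "\<dots> = (\<Sum>c<a. card {v \<in> V. \<kappa> v = c})"
      using assms(1) by (subst card_UN_disjoint) auto
    finally show ?thesis .
  qed
  ultimately show ?thesis by simp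
qed

text \<open>Cut vertices cause no trouble here: deleting a vertex of degree at least
  \<open>2 * Suc a\<close> lowers the edge count by its full degree. Once no such vertex is left, an
  optimal colouring bounds \<open>card V\<close>.\<close>

theorem edge_count_lower_bound:
  assumes "finite V" "diss_bounded V D"
  shows "2 * a * card V \<le> edge_count V + D * a * (a + 1)"
  using assms
proof (induction a arbitrary: V)
  case 0
  then show ?case by simp
next
  case (Suc a)
  from Suc.prems show ?case
  proof (induction V rule: finite_psubset_induct)
    case (psubset V)
    show ?case
    proof (cases "\<exists>v\<in>V. 2 * Suc a \<le> deg V v")
      case True
      then obtain v where v: "v \<in> V" "2 * Suc a \<le> deg V v" by blast
      have "2 * Suc a * card (V - {v}) \<le> edge_count (V - {v}) + D * Suc a * (Suc a + 1)"
        using psubset v diss_bounded_subset[OF psubset.prems, of "V - {v}"] by blast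
      moreover have "edge_count V = edge_count (V - {v}) + deg V v"
        using edge_count_insert[of "V - {v}" v] psubset v by (simp add: insert_absorb deg_remove_self)
      moreover have cV: "card V = Suc (card (V - {v}))"
        using psubset v by (metis card_Suc_Diff1)
      moreover have "2 * Suc a * card V = 2 * Suc a * card (V - {v}) + 2 * Suc a"
        unfolding cV by simp
      ultimately show ?thesis using v(2) by linarith
    next
      case False
      obtain \<kappa> where "optimal (Suc a) V \<kappa>" using optimal_exists[of "Suc a"] by blast
      then have "defective (Suc a) V {} \<kappa>"
        using False psubset(1) by (intro optimal_defective) (auto simp: not_le)
      then have "card V \<le> Suc a * D" using defective_card psubset by blast
      then have "2 * card V \<le> 2 * (Suc a * D)" by simp
      moreover have "2 * a * card V \<le> edge_count V + D * a * (a + 1)"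
        using Suc.IH psubset by blast
      \<comment> \<open>The constant grows by \<open>2 * (Suc a * D)\<close>, just what twice the
        colouring bound on \<open>card V\<close> costs.\<close>
      moreover have "D * Suc a * (Suc a + 1) = D * a * (a + 1) + 2 * (Suc a * D)"
        by (simp add: algebra_simps)
      moreover have "2 * Suc a * card V = 2 * a * card V + 2 * card V" by simp
      ultimately show ?thesis by linarith
    qed
  qed
qed

lemma dissoc_Un:
  assumes "dissoc A" "dissoc B" "\<forall>u\<in>A. \<forall>v\<in>B. \<not> adj u v"
  shows "dissoc (A \<union> B)"
proof -
  have "{u \<in> A \<union> B. adj v u} = {u \<in> A. adj v u}" if "v \<in> A" for v
    using assms(3) that by blast
  moreover have "{u \<in> A \<union> B. adj v u} = {u \<in> B. adj v u}" if "v \<in> B" for v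
    using assms(3) that adj_sym by blast
  ultimately show ?thesis using assms(1,2) unfolding dissoc_def deg_def by auto
qed

lemma dissoc_independent: "\<forall>u\<in>A. \<forall>v\<in>A. \<not> adj u v \<Longrightarrow> dissoc A"
  unfolding dissoc_def deg_def by (metis (no_types, lifting) card.empty empty_Collect_eq zero_le_one)

lemma dissoc_card_2: "finite A \<Longrightarrow> card A \<le> 2 \<Longrightarrow> dissoc A"
  unfolding dissoc_def
proof
  fix v assume A: "finite A" "card A \<le> 2" "v \<in> A"
  have "deg A v \<le> card (A - {v})"
    using deg_remove_self[of A v] A(1) unfolding deg_def by (metis (no_types, lifting) card_mono finite_Diff mem_Collect_eq subsetI)
  then show "deg A v \<le> 1" using A by simp
qed

text \<open>If no vertex removal lowers \<open>phi\<close> by two, the graph is a forest, and a smallest branch with at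
  least two vertices is a star.\<close>

lemma dissoc_two_thirds:
  assumes "finite V"
  shows "\<exists>W\<subseteq>V. dissoc W \<and> 4 * card V \<le> 2 * phi V + 3 * card W"
  using assms
proof (induction V rule: finite_psubset_induct)
  case (psubset V)
  have fin: "finite A" if "A \<subseteq> V" for A
    using that psubset(1) finite_subset by blast
  \<comment> \<open>A block \<open>X\<close> may be split off if at least two thirds of it form a
    dissociation set \<open>Y\<close> without edges to the rest: every deleted vertex lowers
    \<open>phi\<close> by at least one, so \<open>4 * card X\<close> is covered by
    \<open>2 * card X + 3 * card Y\<close>.\<close>
  have reduce: ?case if "X \<subseteq> V" "X \<noteq> {}" "Y \<subseteq> X" "dissoc Y"
    "\<forall>u\<in>Y. \<forall>v\<in>V - X. \<not> adj u v" "2 * card X \<le> 3 * card Y" for X Y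
  proof -
    have "V - X \<subset> V" using that(1,2) by blast
    then obtain W where W: "W \<subseteq> V - X" "dissoc W" "4 * card (V - X) \<le> 2 * phi (V - X) + 3 * card W"
      using psubset(2)[of "V - X"] by blast
    have "dissoc (Y \<union> W)" using W that by (intro dissoc_Un) auto
    moreover have "card (Y \<union> W) = card Y + card W"
      using W(1) that(1,3) by (intro card_Un_disjoint fin) auto
    moreover have "phi (V - X) + card X \<le> phi V" using phi_Diff_ge[OF psubset(1) that(1)] .
    moreover have "card V = card (V - X) + card X"
      using card_Diff_subset[OF fin[OF that(1)] that(1)] card_mono[OF psubset(1) that(1)] by simp
    ultimately have "4 * card V \<le> 2 * phi V + 3 * card (Y \<union> W)" using W(3) that(6) by linarith
    then show ?thesis using \<open>dissoc (Y \<union> W)\<close> W(1) that(1,3) by (intro exI[of _ "Y \<union> W"]) auto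
  qed
  show ?case
  proof (cases "V = {}")
    case True
    then show ?thesis by (intro exI[of _ "{}"]) (auto simp: dissoc_def)
  next
    case ne: False
    show ?thesis
    \<comment> \<open>A drop of two pays the 4 that a vertex adds on the left, so this vertex may be
      left out of \<open>W\<close>.\<close>
    proof (cases "\<exists>v\<in>V. phi (V - {v}) + 2 \<le> phi V")
      case True
      then obtain v where v: "v \<in> V" "phi (V - {v}) + 2 \<le> phi V" by blast
      then have "V - {v} \<subset> V" by blast
      then obtain W where W: "W \<subseteq> V - {v}" "dissoc W"
        and le: "4 * card (V - {v}) \<le> 2 * phi (V - {v}) + 3 * card W"
        using psubset(2)[of "V - {v}"] by blast
      have "card V = Suc (card (V - {v}))" using card_Suc_Diff1[OF psubset(1) v(1)] by simp
      then have "4 * card V \<le> 2 * phi V + 3 * card W" using le v(2) by linarith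
      then show ?thesis using W by (intro exI[of _ W]) blast
    next
      case small: False
      show ?thesis
      proof (cases "conn V")
        case False
        then obtain A where A: "sep V A" "A \<noteq> {}" "A \<noteq> V" using ne by (auto simp: conn_def)
        then have AV: "A \<subset> V" "V - A \<subset> V" by (auto simp: sep_def)
        obtain W where W: "W \<subseteq> A" "dissoc W" "4 * card A \<le> 2 * phi A + 3 * card W"
          using psubset(2)[OF AV(1)] by blast
        obtain W' where W': "W' \<subseteq> V - A" "dissoc W'" "4 * card (V - A) \<le> 2 * phi (V - A) + 3 * card W'"
          using psubset(2)[OF AV(2)] by blast
        have "dissoc (W \<union> W')"
          by (rule dissoc_Un[OF W(2) W'(2)]) (use A(1) W(1) W'(1) in \<open>unfold sep_def, blast\<close>)
        moreover have "card (W \<union> W') = card W + card W'"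
          using W(1) W'(1) AV by (intro card_Un_disjoint fin) auto
        moreover have "card V = card A + card (V - A)"
          using card_Diff_subset[of A V] card_mono[of V A] fin[of A] psubset(1) AV(1) by auto
        ultimately have "4 * card V \<le> 2 * phi V + 3 * card (W \<union> W')"
          using phi_sep[OF psubset(1) A(1)] W(3) W'(3) by linarith
        then show ?thesis using \<open>dissoc (W \<union> W')\<close> W(1) W'(1) AV by (intro exI[of _ "W \<union> W'"]) auto
      next
        case cV: True
        \<comment> \<open>Branches \<open>C\<close> with at least two vertices, together with their
          attachment vertex \<open>p\<close>. If there are none, all of \<open>V - {p}\<close> is
          independent; otherwise a smallest one is examined.\<close>
        let ?P = "\<lambda>(p, C). p \<in> V \<and> sep (V - {p}) C \<and> conn C \<and> 2 \<le> card C"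
        show ?thesis
        proof (cases "\<exists>x. ?P x")
          case False
          obtain p where p: "p \<in> V" using ne by blast
          have ind: "\<not> adj u v" if uv: "u \<in> V - {p}" "v \<in> V - {p}" for u v
          proof
            assume a: "adj u v"
            obtain C where C: "C \<in> comps (V - {p})" "u \<in> C"
              using comps_cover[of "V - {p}" u] psubset(1) uv by auto
            then have "v \<in> C" using a uv sepD[of "V - {p}" C u v] by (auto simp: comps_def)
            moreover have "u \<noteq> v" using a by auto
            moreover have "finite C" using C by (intro fin) (auto simp: comps_def sep_def)
            ultimately have "2 \<le> card C"
              using C(2) card_mono[of C "{u, v}"] by simp
            then show False using False C p by (auto simp: comps_def)
          qed
          show ?thesis
          proof (cases "card V \<le> 2")
            case True
            then show ?thesis
              using reduce[of V V] ne dissoc_card_2[OF psubset(1)] by simp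
          next
            case False
            then have "2 * card V \<le> 3 * card (V - {p})" using p psubset(1) by simp
            then show ?thesis
              using reduce[of V "V - {p}"] ne dissoc_independent[of "V - {p}"] ind by auto
          qed
        next
          case True
          then obtain x where "?P x" and minx: "\<And>y. ?P y \<Longrightarrow> card (snd x) \<le> card (snd y)"
            using ex_has_least_nat[of ?P _ "\<lambda>x. card (snd x)"] by blast
          then obtain p C where p: "p \<in> V" and C: "sep (V - {p}) C" "conn C" "2 \<le> card C"
            and min: "\<And>q D. q \<in> V \<Longrightarrow> sep (V - {q}) D \<Longrightarrow> conn D \<Longrightarrow> 2 \<le> card D \<Longrightarrow> card C \<le> card D"
            by (cases x) auto
          have CV: "C \<subseteq> V - {p}" using C(1) by (simp add: sep_def)
          then have fC: "finite C" using psubset(1) finite_subset by blast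
          have out: "v = p" if "u \<in> C" "v \<in> V - C" "adj u v" for u v
            using C(1) that unfolding sep_def by blast
          have "\<exists>u\<in>C. adj p u"
          proof (rule ccontr)
            assume "\<not> ?thesis"
            then have "sep V C" using out CV adj_sym unfolding sep_def by blast
            then have "C = {} \<or> C = V" using connD[OF cV] by blast
            then show False using CV C(3) p by auto
          qed
          then obtain u where u: "u \<in> C" "adj p u" by blast
          \<comment> \<open>The drop at \<open>p\<close> is at least \<open>deg C p\<close>, because
            the remaining side loses at least one when \<open>p\<close> is deleted. As the drop is
            below two, the branch hangs on the single edge from \<open>p\<close> to
            \<open>u\<close>.\<close>
          have degp: "deg C p \<le> 1"
          proof -
            have iV: "insert p (V - {p}) = V" using p by auto
            have "phi (insert p C) = phi C + deg C p"
              using phi_insert_conn[OF fC C(2)] CV u by blast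
            moreover have "phi V + 1 = phi (insert p C) + phi (insert p (V - {p} - C))"
              using phi_cut_vertex[of "V - {p}" p C] psubset(1) C(1) iV by simp
            moreover have "phi (V - {p}) = phi C + phi (V - {p} - C)"
              using phi_sep[OF _ C(1)] psubset(1) by simp
            moreover have "phi (V - {p} - C) + 1 \<le> phi (insert p (V - {p} - C))"
              using phi_insert_ge[of "V - {p} - C" p] psubset(1) by simp
            moreover have "phi V < phi (V - {p}) + 2" using small p by auto
            ultimately show ?thesis by linarith
          qed
          have onlyu: "w = u" if "w \<in> C" "adj p w" for w
          proof (rule ccontr)
            assume "w \<noteq> u"
            then have "card {w, u} \<le> deg C p"
              unfolding deg_def using that u fC by (intro card_mono) auto
            then show False using degp \<open>w \<noteq> u\<close> by simp
          qed
          have outu: "\<not> adj w v" if "w \<in> C - {u}" "v \<in> V - C" for w v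
            using out[of w v] onlyu[of w] that adj_sym by blast
          \<comment> \<open>A component of \<open>C - {u}\<close> with two vertices would be a
            smaller branch, attached at \<open>u\<close>. Hence \<open>C\<close> is a star with
            centre \<open>u\<close>.\<close>
          have ind: "\<not> adj w w'" if w: "w \<in> C - {u}" "w' \<in> C - {u}" for w w'
          proof
            assume a: "adj w w'"
            obtain K where K: "K \<in> comps (C - {u})" "w \<in> K"
              using comps_cover[of "C - {u}" w] fC w by auto
            then have KC: "K \<subseteq> C - {u}" "sep (C - {u}) K" "conn K" by (auto simp: comps_def sep_def)
            then have "w' \<in> K" using a w K sepD by blast
            moreover have "w \<noteq> w'" using a by auto
            moreover have fK: "finite K" using KC fC finite_subset by blast
            ultimately have "2 \<le> card K" using K(2) card_mono[of K "{w, w'}"] by simp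
            moreover have "sep (V - {u}) K"
              using KC(1,2) outu CV unfolding sep_def by blast
            ultimately have "card C \<le> card K" using min[of u K] u CV KC(3) by blast
            moreover have "card K < card C" using KC(1) u fC by (intro psubset_card_mono) auto
            ultimately show False by simp
          qed
          show ?thesis
          \<comment> \<open>With two vertices, \<open>C - {u}\<close> falls short of two thirds of
            \<open>C\<close>, so \<open>C\<close> is split off together with \<open>p\<close>, which
            gives 2 out of 3. From three vertices on, the leaves suffice.\<close>
          proof (cases "card C = 2")
            case True
            have "card (insert p C) = 3" using True fC CV by (subst card_insert_disjoint) auto
            then show ?thesis
              using reduce[of "insert p C" C] True dissoc_card_2[OF fC] out p CV by auto
          next
            case False
            then have "2 * card C \<le> 3 * card (C - {u})" using C(3) u fC by simp
            then show ?thesis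
            proof (intro reduce[of C "C - {u}"])
              show "dissoc (C - {u})" using ind by (intro dissoc_independent) simp
              show "\<forall>w\<in>C - {u}. \<forall>v\<in>V - C. \<not> adj w v" using outu by simp
            qed (use CV u(1) in auto)
          qed
        qed
      qed
    qed
  qed
qed

section \<open>Colour counts after recolouring one vertex\<close>

lemma cdeg_upd_nonadj: "\<not> adj v x \<Longrightarrow> cdeg V (\<kappa>(x := c)) v d = cdeg V \<kappa> v d"
  unfolding cdeg_def by (rule arg_cong[of _ _ card]) auto

lemma cdeg_upd_self: "cdeg V (\<kappa>(v := c)) v d = cdeg V \<kappa> v d"
  by (rule cdeg_upd_nonadj) simp

lemma cdeg_upd_other_le: "finite V \<Longrightarrow> d \<noteq> c \<Longrightarrow> cdeg V (\<kappa>(x := c)) v d \<le> cdeg V \<kappa> v d"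
  unfolding cdeg_def by (rule card_mono) auto

lemma cdeg_upd_new:
  assumes "finite V" "x \<in> V" "adj v x" "\<kappa> x \<noteq> c"
  shows "cdeg V (\<kappa>(x := c)) v c = cdeg V \<kappa> v c + 1"
proof -
  have "{u \<in> V. adj v u \<and> (\<kappa>(x := c)) u = c} = insert x {u \<in> V. adj v u \<and> \<kappa> u = c}"
    using assms by auto
  then show ?thesis using assms by (simp add: cdeg_def)
qed

lemma cdeg_upd_old:
  assumes "finite V" "x \<in> V" "adj v x" "\<kappa> x \<noteq> c"
  shows "cdeg V (\<kappa>(x := c)) v (\<kappa> x) + 1 = cdeg V \<kappa> v (\<kappa> x)"
proof -
  have "{u \<in> V. adj v u \<and> \<kappa> u = \<kappa> x} = insert x {u \<in> V. adj v u \<and> (\<kappa>(x := c)) u = \<kappa> x}"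
    using assms by auto
  then show ?thesis using assms by (simp add: cdeg_def)
qed

lemma cdeg_pos: "finite V \<Longrightarrow> u \<in> V \<Longrightarrow> adj v u \<Longrightarrow> 0 < cdeg V \<kappa> v (\<kappa> u)"
  unfolding cdeg_def card_gt_0_iff by auto

text \<open>Otherwise each of the \<open>a - 1\<close> colours other than \<open>c\<close> would
  occur at least \<open>m\<close> times around \<open>v\<close>.\<close>

lemma cdeg_pigeonhole:
  assumes "finite V" "\<forall>u\<in>V. \<kappa> u < a" "c < a" "deg V v < cdeg V \<kappa> v c + m * (a - 1)"
  shows "\<exists>d<a. d \<noteq> c \<and> cdeg V \<kappa> v d < m"
proof (rule ccontr)
  assume n: "\<not> ?thesis"
  have "m \<le> cdeg V \<kappa> v d" if d: "d \<in> {..<a} - {c}" for d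
    using n d not_less by blast
  then have "(\<Sum>d\<in>{..<a} - {c}. m) \<le> (\<Sum>d\<in>{..<a} - {c}. cdeg V \<kappa> v d)" by (rule sum_mono)
  moreover have "deg V v = cdeg V \<kappa> v c + (\<Sum>d\<in>{..<a} - {c}. cdeg V \<kappa> v d)"
    using sum_cdeg[OF assms(1,2), of v] assms(3) sum.remove[of "{..<a}" c "cdeg V \<kappa> v"] by simp
  ultimately show False using assms(3,4) by (simp add: mult.commute)
qed

lemma mono_edges_le:
  assumes "finite V"
    and "\<And>u v. u \<in> V \<Longrightarrow> v \<in> V \<Longrightarrow> adj u v \<Longrightarrow> \<kappa>' u = \<kappa>' v \<Longrightarrow> \<kappa> u = \<kappa> v"
  shows "mono_edges V \<kappa>' \<le> mono_edges V \<kappa>"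
  unfolding mono_edges_def
proof (rule card_mono)
  show "finite {e \<in> E. e \<subseteq> V \<and> (\<forall>x\<in>e. \<forall>y\<in>e. \<kappa> x = \<kappa> y)}"
    by (rule finite_subset[of _ "Pow V"]) (use assms in auto)
  show "{e \<in> E. e \<subseteq> V \<and> (\<forall>x\<in>e. \<forall>y\<in>e. \<kappa>' x = \<kappa>' y)}
      \<subseteq> {e \<in> E. e \<subseteq> V \<and> (\<forall>x\<in>e. \<forall>y\<in>e. \<kappa> x = \<kappa> y)}"
  proof
    fix e assume "e \<in> {e \<in> E. e \<subseteq> V \<and> (\<forall>x\<in>e. \<forall>y\<in>e. \<kappa>' x = \<kappa>' y)}"
    then have e: "e \<in> E" "e \<subseteq> V" "\<And>x y. x \<in> e \<Longrightarrow> y \<in> e \<Longrightarrow> \<kappa>' x = \<kappa>' y" by blast+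
    have "\<kappa> x = \<kappa> y" if xy: "x \<in> e" "y \<in> e" for x y
    proof (cases "x = y")
      case False
      obtain s t where "e = {s, t}" using card_edge[OF e(1)] by (auto simp: card_2_iff)
      then have "e = {x, y}" using xy False by auto
      then have "adj x y" using e(1) by simp
      then show ?thesis using assms(2)[of x y] e(2) e(3)[OF xy] xy by blast
    qed simp
    then show "e \<in> {e \<in> E. e \<subseteq> V \<and> (\<forall>x\<in>e. \<forall>y\<in>e. \<kappa> x = \<kappa> y)}" using e(1,2) by blast
  qed
qed

section \<open>Branches at a cut vertex\<close>

text \<open>In an optimal colouring \<open>q\<close> has exactly one neighbour of each colour, and the neighbour \<open>x\<close> sharing
  the colour of \<open>q\<close> has exactly two neighbours of each other colour. Moving \<open>x\<close> to another colour \<open>c'\<close>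
  frees \<open>q\<close>, and the surplus can be pushed on unless both neighbours of \<open>x\<close> of colour \<open>c'\<close> have full
  degree. If such a vertex disconnects \<open>C\<close>, exchanging two colours on one side shows that it
  separates \<open>x\<close> from the neighbour of \<open>q\<close> of colour \<open>c'\<close>; this cannot hold for both of them.\<close>

lemma critical_branch:
  assumes fC: "finite C" and qC: "q \<notin> C" and cC: "conn C" and a: "2 \<le> a" and dq: "deg C q = a"
    and degC: "\<And>v. v \<in> C \<Longrightarrow> deg (insert q C) v < (if v \<in> Z then a else 2 * a)"
    and nocut: "\<And>v. v \<in> C \<Longrightarrow> conn (insert q C - {v})"
    and bad: "\<And>\<kappa>. \<not> defective a (insert q C) (insert q Z) \<kappa>"
  shows "\<exists>y\<in>C. y \<notin> Z \<and> \<not> adj q y \<and> deg C y = 2 * a - 1 \<and> conn (C - {y})"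
proof -
  define B where "B = insert q C"
  have fB: "finite B" and qB: "q \<in> B" and CB: "C \<subseteq> B" using fC by (auto simp: B_def)
  have dqB: "deg B q = a" using dq by (simp add: B_def deg_insert_self)
  have deg2: "deg B v < 2 * a" if "v \<in> B" for v
    using that degC[of v] dqB a by (auto simp: B_def split: if_splits)
  have degZ: "deg B v < a" if "v \<in> C" "v \<in> Z" for v
    using that degC[of v] by (simp add: B_def)
  define R where "R \<kappa> \<longleftrightarrow> (\<forall>v\<in>B. \<kappa> v < a)" for \<kappa> :: "'a \<Rightarrow> nat"
  have R_upd: "R (\<kappa>(v := c))" if "R \<kappa>" "c < a" for \<kappa> v c using that by (simp add: R_def)
  obtain \<kappa> where opt: "optimal a B \<kappa>" using optimal_exists[of a] a by auto
  define \<mu> where "\<mu> = mono_edges B \<kappa>"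
  have R\<kappa>: "R \<kappa>" using opt by (simp add: optimal_def R_def)
  have low: "\<mu> \<le> mono_edges B \<kappa>'" if "R \<kappa>'" for \<kappa>'
    using opt that by (auto simp: optimal_def R_def \<mu>_def)
  have opt': "optimal a B \<kappa>'" if "R \<kappa>'" "mono_edges B \<kappa>' \<le> \<mu>" for \<kappa>'
    using that low unfolding optimal_def R_def by (meson le_trans)
  \<comment> \<open>By the degree bounds an optimal colouring can violate \<open>defective\<close>
    only at \<open>q\<close>. Hence no colouring with \<open>\<mu>\<close> monochromatic edges
    isolates \<open>q\<close> in its class; the moves below try to reach one.\<close>
  have noq: False if k: "R \<kappa>'" "mono_edges B \<kappa>' \<le> \<mu>" "cdeg B \<kappa>' q (\<kappa>' q) = 0" for \<kappa>'
  proof -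
    have o: "optimal a B \<kappa>'" using opt' k by blast
    have "cdeg B \<kappa>' v (\<kappa>' v) \<le> (if v \<in> insert q Z then 0 else 1)" if v: "v \<in> B" for v
      using optimal_le_1[OF fB o v deg2[OF v]] optimal_eq_0[OF fB o v] degZ[of v] v k(3)
      by (auto simp: B_def)
    then have "defective a B (insert q Z) \<kappa>'" using k(1) by (simp add: defective_def R_def)
    then show False using bad by (simp add: B_def)
  qed
  \<comment> \<open>Every colour occurs at least once around \<open>q\<close>, and there are
    \<open>a\<close> colours but only \<open>a\<close> neighbours.\<close>
  have q1: "cdeg B \<kappa> q d = 1" if "d < a" for d
  proof -
    have "cdeg B \<kappa> q (\<kappa> q) \<noteq> 0" using noq[OF R\<kappa>] by (auto simp: \<mu>_def)
    then have ge: "1 \<le> cdeg B \<kappa> q i" if "i < a" for i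
      using optimal_le[OF fB opt qB that] by simp
    have "(\<Sum>i<a. 1) = (\<Sum>i<a. cdeg B \<kappa> q i)"
      using sum_cdeg[OF fB, of \<kappa> a q] R\<kappa> dqB by (simp add: R_def)
    from sum_mono_inv[OF this, of d] ge that show ?thesis by simp
  qed
  have q_ex: "\<exists>u\<in>C. adj q u \<and> \<kappa> u = d" if "d < a" for d
  proof -
    have "{u \<in> B. adj q u \<and> \<kappa> u = d} \<noteq> {}"
      using q1[OF that] unfolding cdeg_def by (metis card.empty zero_neq_one)
    then show ?thesis by (auto simp: B_def)
  qed
  have q_unique: "u = u'" if "u \<in> C" "adj q u" "u' \<in> C" "adj q u'" "\<kappa> u = \<kappa> u'" for u u'
  proof -
    have "\<kappa> u < a" using R\<kappa> that(1) by (simp add: R_def B_def)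
    then have "card {v \<in> B. adj q v \<and> \<kappa> v = \<kappa> u} = 1" using q1 by (simp add: cdeg_def)
    then obtain w where w: "{v \<in> B. adj q v \<and> \<kappa> v = \<kappa> u} = {w}" by (auto simp: card_1_singleton_iff)
    have "u \<in> {v \<in> B. adj q v \<and> \<kappa> v = \<kappa> u}" "u' \<in> {v \<in> B. adj q v \<and> \<kappa> v = \<kappa> u}"
      using that CB by auto
    then show ?thesis unfolding w by simp
  qed
  define c where "c = \<kappa> q"
  have ca: "c < a" using R\<kappa> qB by (simp add: R_def c_def)
  obtain x where x: "x \<in> C" "adj q x" "\<kappa> x = c" using q_ex[OF ca] by blast
  have xB: "x \<in> B" using x CB by blast
  have xq: "adj x q" using x adj_sym by blast
  have x_ne: "x \<noteq> q" using x qC by blast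
  have mx: "cdeg B \<kappa> x c = 1"
    using cdeg_pos[OF fB qB xq, of \<kappa>] optimal_le_1[OF fB opt xB deg2[OF xB]] x(3)
    by (simp add: c_def)
  have xZ: "x \<notin> Z"
    using optimal_eq_0[OF fB opt xB] degZ[OF x(1)] mx x(3) by auto
  have qold: "cdeg B (\<kappa>(x := d)) q c = 0" if "d \<noteq> c" for d
    using cdeg_upd_old[OF fB xB x(2), of \<kappa> d] that x(3) q1[OF ca] by simp
  \<comment> \<open>Moving \<open>x\<close> away frees \<open>q\<close>, and it costs nothing if the
    new colour occurs at most once around \<open>x\<close>.\<close>
  have x2: "2 \<le> cdeg B \<kappa> x d" if d: "d < a" "d \<noteq> c" for d
  proof (rule ccontr)
    assume "\<not> ?thesis"
    then have "mono_edges B (\<kappa>(x := d)) \<le> \<mu>"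
      using mono_edges_recolour[OF fB xB, of \<kappa> d] mx x(3) by (simp add: \<mu>_def)
    then show False using noq[OF R_upd[OF R\<kappa> d(1)], of x] qold[OF d(2)] x_ne by (simp add: c_def)
  qed
  \<comment> \<open>A third neighbour in one colour would give \<open>x\<close> degree at least
    \<open>1 + 3 + 2 * (a - 2) = 2 * a\<close>.\<close>
  have x2': "cdeg B \<kappa> x d = 2" if d: "d < a" "d \<noteq> c" for d
  proof (rule ccontr)
    assume "cdeg B \<kappa> x d \<noteq> 2"
    then have 3: "3 \<le> cdeg B \<kappa> x d" using x2[OF d] by simp
    have "(\<Sum>i<a. cdeg B \<kappa> x i) = deg B x" using sum_cdeg[OF fB] R\<kappa> by (simp add: R_def)
    moreover have "(\<Sum>i<a. cdeg B \<kappa> x i)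
        = cdeg B \<kappa> x c + (cdeg B \<kappa> x d + (\<Sum>i\<in>{..<a} - {c} - {d}. cdeg B \<kappa> x i))"
      using ca d by (simp add: sum.remove[of _ c] sum.remove[of _ d])
    moreover have "(\<Sum>i\<in>{..<a} - {c} - {d}. 2) \<le> (\<Sum>i\<in>{..<a} - {c} - {d}. cdeg B \<kappa> x i)"
      by (rule sum_mono) (use x2 in auto)
    moreover have "card ({..<a} - {c} - {d}) = a - 2" using ca d by simp
    ultimately have "1 + 3 + 2 * (a - 2) \<le> deg B x" using 3 mx by simp
    then show False using deg2[OF xB] a by linarith
  qed
  define c' where "c' = (if c = 0 then 1 else 0 :: nat)"
  have c': "c' < a" "c' \<noteq> c" using a by (auto simp: c'_def)
  obtain y1 y2 where Y: "y1 \<noteq> y2" "{u \<in> B. adj x u \<and> \<kappa> u = c'} = {y1, y2}"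
    using x2'[OF c'] unfolding cdeg_def by (auto simp: card_2_iff)
  \<comment> \<open>Giving \<open>q\<close> the colour of \<open>u\<close> is again optimal, since
    all colours occur once around \<open>q\<close>. Then \<open>q\<close> itself is the one
    neighbour of its colour that \<open>u\<close> can have.\<close>
  have Xprop: "cdeg B \<kappa> u (\<kappa> u) = 0 \<and> u \<notin> Z" if u: "u \<in> C" "adj q u" "\<kappa> u \<noteq> c" for u
  proof -
    let ?\<kappa> = "\<kappa>(q := \<kappa> u)"
    have uB: "u \<in> B" and uq: "adj u q" "u \<noteq> q" using u CB qC adj_sym by blast+
    have ua: "\<kappa> u < a" using R\<kappa> uB by (simp add: R_def)
    have "mono_edges B ?\<kappa> \<le> \<mu>"
      using mono_edges_recolour[OF fB qB, of \<kappa> "\<kappa> u"] q1[OF ua] q1[OF ca] by (simp add: \<mu>_def c_def)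
    then have o: "optimal a B ?\<kappa>" using opt' R_upd[OF R\<kappa> ua] by blast
    have "cdeg B ?\<kappa> u (\<kappa> u) = cdeg B \<kappa> u (\<kappa> u) + 1"
      using cdeg_upd_new[OF fB qB uq(1), of \<kappa> "\<kappa> u"] u(3) by (simp add: c_def)
    then show ?thesis
      using optimal_le_1[OF fB o uB deg2[OF uB]] optimal_eq_0[OF fB o uB] degZ[OF u(1)] uq by auto
  qed
  \<comment> \<open>This frees \<open>q\<close> at the price of one additional monochromatic edge;
    any later move that saves an edge and keeps \<open>q\<close> free is a contradiction.\<close>
  define \<kappa>1 where "\<kappa>1 = \<kappa>(x := c')"
  have R1: "R \<kappa>1" using R_upd[OF R\<kappa> c'(1)] by (simp add: \<kappa>1_def)
  have R1': "\<forall>u\<in>B. \<kappa>1 u < a" using R1 by (simp add: R_def)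
  have mono1: "mono_edges B \<kappa>1 = \<mu> + 1"
    using mono_edges_recolour[OF fB xB, of \<kappa> c'] mx x2'[OF c'] x(3) by (simp add: \<mu>_def \<kappa>1_def)
  have q\<kappa>1: "\<kappa>1 q = c" using x_ne by (simp add: \<kappa>1_def c_def)
  have q0: "cdeg B \<kappa>1 q c = 0" using qold[OF c'(2)] by (simp add: \<kappa>1_def)
  have Ystep: False
    if y: "y \<in> C" "\<not> adj q y" and d: "d < a" "cdeg B \<kappa>1 y d < cdeg B \<kappa>1 y (\<kappa>1 y)" for y d
  proof -
    have yB: "y \<in> B" "y \<noteq> q" using y(1) CB qC by blast+
    have "mono_edges B (\<kappa>1(y := d)) \<le> \<mu>"
      using mono_edges_recolour[OF fB yB(1), of \<kappa>1 d] mono1 d(2) by simp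
    moreover have "cdeg B (\<kappa>1(y := d)) q c = 0" using cdeg_upd_nonadj[OF y(2)] q0 by simp
    ultimately show False using noq[OF R_upd[OF R1 d(1)], of y] q\<kappa>1 yB(2) by simp
  qed
  have Yup: "cdeg B \<kappa>1 y c' = cdeg B \<kappa> y c' + 1" if "adj x y" for y
    using cdeg_upd_new[OF fB xB, of y \<kappa> c'] adj_sym[OF that] x(3) c'(2) by (simp add: \<kappa>1_def)
  \<comment> \<open>After the move, \<open>y\<close> has \<open>x\<close> as a neighbour of its
    colour. If \<open>y\<close> is in \<open>Z\<close> or had such a neighbour before, the
    pigeonhole principle yields a saving move of \<open>y\<close>, unless \<open>y\<close> is
    adjacent to \<open>q\<close>, which \<open>Xprop\<close> settles.\<close>
  have Yprop: "y \<in> C \<and> y \<notin> Z \<and> cdeg B \<kappa> y c' = 0 \<and> \<kappa>1 y = c'"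
    if y: "y \<in> B" "adj x y" "\<kappa> y = c'" for y
  proof -
    have yC: "y \<in> C" using y c'(2) by (auto simp: B_def c_def)
    have k1: "\<kappa>1 y = c'" using y by (simp add: \<kappa>1_def)
    have "y \<notin> Z \<and> cdeg B \<kappa> y c' = 0"
    proof (cases "adj q y")
      case True
      then show ?thesis using Xprop[OF yC True] y(3) c'(2) by simp
    next
      case False
      have "y \<notin> Z"
      proof
        assume "y \<in> Z"
        then have "deg B y < cdeg B \<kappa>1 y c' + 1 * (a - 1)" using degZ[OF yC] Yup[OF y(2)] a by simp
        then obtain d where "d < a" "d \<noteq> c'" "cdeg B \<kappa>1 y d < 1"
          using cdeg_pigeonhole[OF fB R1' c'(1)] by blast
        then show False using Ystep[OF yC False, of d] Yup[OF y(2)] k1 by simp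
      qed
      moreover have "cdeg B \<kappa> y c' = 0"
      proof (rule ccontr)
        assume "cdeg B \<kappa> y c' \<noteq> 0"
        then have 2: "2 \<le> cdeg B \<kappa>1 y c'" using Yup[OF y(2)] by simp
        then have "deg B y < cdeg B \<kappa>1 y c' + 2 * (a - 1)" using deg2[OF y(1)] a by simp
        then obtain d where "d < a" "d \<noteq> c'" "cdeg B \<kappa>1 y d < 2"
          using cdeg_pigeonhole[OF fB R1' c'(1)] by blast
        then show False using Ystep[OF yC False, of d] 2 k1 by simp
      qed
      ultimately show ?thesis ..
    qed
    then show ?thesis using yC k1 by blast
  qed
  \<comment> \<open>With a smaller degree some colour \<open>d\<close> occurs just once around
    \<open>y\<close>, at a vertex \<open>w\<close>. Moving \<open>y\<close> to \<open>d\<close>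
    passes the surplus on to \<open>w\<close>, which can absorb it: the colouring
    \<open>\<kappa>2\<close> is defective although it has \<open>\<mu> + 1\<close> monochromatic
    edges.\<close>
  have full: "deg B y = 2 * a - 1" if y: "y \<in> B" "adj x y" "\<kappa> y = c'" "\<not> adj q y" for y
  proof (rule ccontr)
    assume "deg B y \<noteq> 2 * a - 1"
    then have small: "deg B y < 2 * a - 1" using deg2[OF y(1)] by simp
    have yp: "y \<in> C" "y \<notin> Z" "cdeg B \<kappa> y c' = 0" "\<kappa>1 y = c'"
      using Yprop[OF y(1-3)] by simp_all
    have y1': "cdeg B \<kappa>1 y c' = 1" using Yup[OF y(2)] yp(3) by simp
    have "deg B y < cdeg B \<kappa>1 y c' + 2 * (a - 1)" using small a y1' by linarith
    then obtain d where d: "d < a" "d \<noteq> c'" "cdeg B \<kappa>1 y d < 2"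
      using cdeg_pigeonhole[OF fB R1' c'(1)] by blast
    then have d1: "cdeg B \<kappa>1 y d = 1" using Ystep[OF yp(1) y(4), of d] y1' yp(4) by fastforce
    then obtain w where W: "{u \<in> B. adj y u \<and> \<kappa>1 u = d} = {w}"
      unfolding cdeg_def by (auto simp: card_1_singleton_iff)
    then have w: "w \<in> B" "adj y w" "\<kappa>1 w = d" by blast+
    have yq: "y \<noteq> q" "x \<noteq> y" using yp(1) qC y(2) by auto
    have w_ne: "w \<noteq> q" "w \<noteq> x" "w \<noteq> y"
      using w y(4) adj_sym d(2) by (auto simp: \<kappa>1_def)
    have wC: "w \<in> C" using w(1) w_ne by (simp add: B_def)
    have \<kappa>w: "\<kappa> w = d" using w(3) w_ne by (simp add: \<kappa>1_def)
    define \<kappa>2 where "\<kappa>2 = \<kappa>1(y := d)"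
    have R2: "R \<kappa>2" using R_upd[OF R1 d(1)] by (simp add: \<kappa>2_def)
    have R2': "\<forall>u\<in>B. \<kappa>2 u < a" using R2 by (simp add: R_def)
    have mono2: "mono_edges B \<kappa>2 = \<mu> + 1"
      using mono_edges_recolour[OF fB y(1), of \<kappa>1 d] mono1 y1' d1 yp(4) by (simp add: \<kappa>2_def)
    have q2: "cdeg B \<kappa>2 q c = 0" "\<kappa>2 q = c"
      using cdeg_upd_nonadj[OF y(4)] q0 q\<kappa>1 yq by (simp_all add: \<kappa>2_def)
    have \<kappa>2w: "\<kappa>2 w = d" using w(3) w_ne by (simp add: \<kappa>2_def)
    have w2: "cdeg B \<kappa>2 w d = cdeg B \<kappa>1 w d + 1"
      using cdeg_upd_new[OF fB y(1), of w \<kappa>1 d] adj_sym[OF w(2)] yp(4) d(2) by (simp add: \<kappa>2_def)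
    have w1le: "cdeg B \<kappa>1 w d \<le> cdeg B \<kappa> w d"
      using cdeg_upd_other_le[OF fB d(2)] by (simp add: \<kappa>1_def)
    have wadj: "cdeg B \<kappa>1 w d = 0 \<and> w \<notin> Z" if aw: "adj q w"
    proof -
      have "\<kappa> w \<noteq> c" using q_unique[OF wC aw x(1,2)] x(3) w_ne by auto
      then show ?thesis using Xprop[OF wC aw] \<kappa>w w1le by simp
    qed
    have Wstep: False if e: "e < a" "cdeg B \<kappa>2 w e < cdeg B \<kappa>2 w d" "\<not> adj q w" for e
    proof -
      have "mono_edges B (\<kappa>2(w := e)) \<le> \<mu>"
        using mono_edges_recolour[OF fB w(1), of \<kappa>2 e] mono2 e(2) \<kappa>2w by simp
      moreover have "cdeg B (\<kappa>2(w := e)) q c = 0" using cdeg_upd_nonadj[OF e(3)] q2 by simp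
      ultimately show False using noq[OF R_upd[OF R2 e(1)], of w] q2(2) w_ne(1) by simp
    qed
    have wZ: "w \<notin> Z"
    proof
      assume wZ: "w \<in> Z"
      then have na: "\<not> adj q w" using wadj by auto
      have "deg B w < cdeg B \<kappa>2 w d + 1 * (a - 1)" using degZ[OF wC wZ] w2 by simp
      then obtain e where "e < a" "cdeg B \<kappa>2 w e < 1"
        using cdeg_pigeonhole[OF fB R2' d(1)] by blast
      then show False using Wstep[OF _ _ na, of e] w2 by simp
    qed
    have w0: "cdeg B \<kappa>1 w d = 0"
    proof (rule ccontr)
      assume n: "cdeg B \<kappa>1 w d \<noteq> 0"
      then have na: "\<not> adj q w" using wadj by auto
      have 2: "2 \<le> cdeg B \<kappa>2 w d" using w2 n by simp
      then have "deg B w < cdeg B \<kappa>2 w d + 2 * (a - 1)" using deg2[OF w(1)] by simp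
      then obtain e where "e < a" "cdeg B \<kappa>2 w e < 2"
        using cdeg_pigeonhole[OF fB R2' d(1)] by blast
      then show False using Wstep[OF _ _ na, of e] 2 by simp
    qed
    have "cdeg B \<kappa>2 v (\<kappa>2 v) \<le> (if v \<in> insert q Z then 0 else 1)" if v: "v \<in> B" for v
    proof -
      consider "v = q" | "v = x" | "v = y" | "v = w" | "v \<noteq> q" "v \<noteq> x" "v \<noteq> y" "v \<noteq> w" by blast
      then show ?thesis
      proof cases
        case 1
        then show ?thesis using q2 by simp
      next
        case 2
        have k: "\<kappa>2 x = c'" using yq(2) by (simp add: \<kappa>2_def \<kappa>1_def)
        have "cdeg B \<kappa>1 x c' = 2" using x2'[OF c'] cdeg_upd_self by (simp add: \<kappa>1_def)
        then have "cdeg B \<kappa>2 x c' = 1"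
          using cdeg_upd_old[OF fB y(1,2), of \<kappa>1 d] yp(4) d(2) by (simp add: \<kappa>2_def)
        then show ?thesis using 2 k xZ x_ne by simp
      next
        case 3
        have "cdeg B \<kappa>2 y d = 1" using cdeg_upd_self d1 by (simp add: \<kappa>2_def)
        then show ?thesis using 3 yp(2) yq by (simp add: \<kappa>2_def)
      next
        case 4
        then show ?thesis using w2 w0 \<kappa>2w wZ w_ne by simp
      next
        case 5
        have kv: "\<kappa>2 v = \<kappa> v" "\<kappa>1 v = \<kappa> v" using 5 by (auto simp: \<kappa>2_def \<kappa>1_def)
        have s2: "cdeg B \<kappa>2 v (\<kappa> v) \<le> cdeg B \<kappa>1 v (\<kappa> v)"
        proof (cases "adj v y \<and> \<kappa> v = d")
          case True
          then have "v = w" using W v kv adj_sym[of v y] by blast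
          then show ?thesis using 5 by blast
        next
          case False
          then show ?thesis
            using cdeg_upd_nonadj[of v y B \<kappa>1 d] cdeg_upd_other_le[OF fB, of "\<kappa> v" d \<kappa>1 y v]
            unfolding \<kappa>2_def by fastforce
        qed
        show ?thesis
        proof (cases "adj v x \<and> \<kappa> v = c'")
          case True
          then have xv: "adj x v" using adj_sym by blast
          then have "v \<notin> Z" "cdeg B \<kappa>1 v c' = 1" using Yprop[OF v xv] Yup[OF xv] True by auto
          then show ?thesis using s2 True kv 5 by simp
        next
          case False
          have "cdeg B \<kappa>1 v (\<kappa> v) \<le> cdeg B \<kappa> v (\<kappa> v)"
            using False cdeg_upd_nonadj[of v x B \<kappa> c'] cdeg_upd_other_le[OF fB, of "\<kappa> v" c' \<kappa> x v]
            unfolding \<kappa>1_def by fastforce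
          then have "cdeg B \<kappa>2 v (\<kappa>2 v) \<le> cdeg B \<kappa> v (\<kappa> v)" using s2 kv by simp
          then show ?thesis
            using optimal_le_1[OF fB opt v deg2[OF v]] optimal_eq_0[OF fB opt v] degZ[of v] v 5(1)
            by (auto simp: B_def)
        qed
      qed
    qed
    then have "defective a B (insert q Z) \<kappa>2" using R2' by (simp add: defective_def)
    then show False using bad by (simp add: B_def)
  qed
  have degBC: "deg B y = deg C y" if "\<not> adj q y" for y
  proof -
    have "{u \<in> B. adj y u} = {u \<in> C. adj y u}" using that adj_sym by (auto simp: B_def)
    then show ?thesis by (simp add: deg_def)
  qed
  obtain x' where x': "x' \<in> C" "adj q x'" "\<kappa> x' = c'" using q_ex[OF c'(1)] by blast
  have xx': "x \<noteq> x'" using x x' c' by auto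
  show ?thesis
  proof (rule ccontr)
    assume contra: "\<not> ?thesis"
    \<comment> \<open>A non-neighbour \<open>y\<close> of \<open>q\<close> has full degree, so by
      \<open>contra\<close> it disconnects \<open>C\<close>. It remains to exclude that
      \<open>x\<close> and \<open>x'\<close> lie on the same side.\<close>
    have split: "\<exists>K. sep (C - {y}) K \<and> x' \<in> K \<and> x \<notin> K"
      if y: "y \<in> B" "adj x y" "\<kappa> y = c'" "\<not> adj q y" for y
    proof -
      have yp: "y \<in> C" "y \<notin> Z" using Yprop[OF y(1-3)] by simp_all
      then have "\<not> conn (C - {y})" using contra y full[OF y] degBC[OF y(4)] by auto
      moreover have x'y: "x' \<in> C - {y}" "x \<in> C - {y}" using x' x y by auto
      ultimately obtain X0 where X0: "sep (C - {y}) X0" "X0 \<noteq> {}" "X0 \<noteq> C - {y}"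
        by (auto simp: conn_def)
      define X where "X = (if x' \<in> X0 then X0 else C - {y} - X0)"
      have X: "sep (C - {y}) X" "x' \<in> X" "X \<noteq> C - {y}"
        using X0 sep_compl[OF X0(1)] x'y by (auto simp: X_def sep_def)
      show ?thesis
      proof (cases "x \<in> X")
        case False
        then show ?thesis using X by blast
      next
        case xX: True
        define D where "D = C - {y} - X"
        have D: "sep (C - {y}) D" "D \<noteq> {}" "x \<notin> D" "x' \<notin> D" "D \<subseteq> C - {y}"
          using sep_compl[OF X(1)] X xX by (auto simp: D_def sep_def)
        \<comment> \<open>Otherwise \<open>y\<close> would also cut \<open>D\<close> off from
          \<open>q\<close>, against \<open>nocut\<close>.\<close>
        have "\<exists>u\<in>D. adj q u"
        proof (rule ccontr)
          assume n: "\<not> ?thesis"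
          have "sep (insert q C - {y}) D"
            unfolding sep_def
          proof (intro conjI ballI)
            show "D \<subseteq> insert q C - {y}" using D(5) by blast
            fix u v assume uv: "u \<in> D" "v \<in> insert q C - {y} - D"
            show "\<not> adj u v"
            proof (cases "v = q")
              case True then show ?thesis using n uv(1) adj_sym by blast
            next
              case False
              then show ?thesis using sepD[OF D(1) uv(1), of v] uv(2) by blast
            qed
          qed
          then have "D = {} \<or> D = insert q C - {y}" using nocut[OF yp(1)] connD by blast
          then show False using D(2,5) qC yp(1) by blast
        qed
        then obtain u where u: "u \<in> D" "adj q u" by blast
        have uC: "u \<in> C" using u D by blast
        define e where "e = \<kappa> u"
        have ea: "e < a" using R\<kappa> uC by (simp add: R_def B_def e_def)
        have ec: "e \<noteq> c" "e \<noteq> c'"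
          using q_unique[OF uC u(2) x(1,2)] q_unique[OF uC u(2) x'(1,2)] x(3) x'(3) u(1) D(3,4)
          by (auto simp: e_def)
        \<comment> \<open>Colours \<open>c\<close> and \<open>e\<close> are exchanged inside
          \<open>D\<close>, and \<open>q\<close> receives \<open>e\<close>. In \<open>C\<close> only
          \<open>y\<close> links \<open>D\<close> to the rest, and its colour \<open>c'\<close> is
          fixed by \<open>\<tau>\<close>, so no monochromatic edge arises in \<open>C\<close>. The
          only neighbour of \<open>q\<close> with colour \<open>e\<close> was \<open>u\<close>,
          which has lost it; the only one with colour \<open>c\<close> is \<open>x\<close>, outside
          \<open>D\<close>. Thus \<open>q\<close> becomes free and the count falls below
          \<open>\<mu>\<close>.\<close>
        define \<tau> where "\<tau> i = (if i = e then c else if i = c then e else i)" for i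
        have \<tau>: "\<tau> i = \<tau> j \<Longrightarrow> i = j" "\<tau> i = c' \<Longrightarrow> i = c'" for i j
          using ec c'(2) by (auto simp: \<tau>_def split: if_splits)
        define \<kappa>' where "\<kappa>' v = (if v = q then e else if v \<in> D then \<tau> (\<kappa> v) else \<kappa> v)" for v
        have "R \<kappa>'" using R\<kappa> ea ca by (simp add: R_def \<kappa>'_def \<tau>_def)
        have cross: "\<kappa> s = \<kappa> t" if "s \<in> D" "t \<in> C" "t \<notin> D" "adj s t" "\<kappa>' s = \<kappa>' t" for s t
        proof -
          have "t = y" using that sepD[OF D(1), of s t] by blast
          moreover have "s \<noteq> q" "t \<noteq> q" using that D(5) qC by auto
          ultimately show ?thesis using that y(3) \<tau>(2)[of "\<kappa> s"] by (simp add: \<kappa>'_def)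
        qed
        have "mono_edges C \<kappa>' \<le> mono_edges C \<kappa>"
        proof (rule mono_edges_le[OF fC])
          fix s t assume st: "s \<in> C" "t \<in> C" "adj s t" "\<kappa>' s = \<kappa>' t"
          have sq: "s \<noteq> q" "t \<noteq> q" using st qC by auto
          consider "s \<in> D" "t \<in> D" | "s \<in> D" "t \<notin> D" | "s \<notin> D" "t \<in> D" | "s \<notin> D" "t \<notin> D"
            by blast
          then show "\<kappa> s = \<kappa> t"
          proof cases
            case 1
            then have "\<tau> (\<kappa> s) = \<tau> (\<kappa> t)" using st(4) sq by (simp add: \<kappa>'_def)
            then show ?thesis by (rule \<tau>(1))
          next
            case 2
            then show ?thesis using cross[OF _ st(2) _ st(3,4)] by blast
          next
            case 3
            then show ?thesis using cross[OF _ st(1) _ adj_sym[OF st(3)] st(4)[symmetric]] by simp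
          next
            case 4
            then show ?thesis using st(4) sq by (simp add: \<kappa>'_def)
          qed
        qed
        moreover have "cdeg C \<kappa>' q e = 0"
        proof -
          have "\<kappa>' v \<noteq> e" if v: "v \<in> C" "adj q v" for v
          proof
            assume ke: "\<kappa>' v = e"
            have "v \<noteq> q" using v qC by blast
            show False
            proof (cases "v \<in> D")
              case True
              then have "\<tau> (\<kappa> v) = e" using ke \<open>v \<noteq> q\<close> by (simp add: \<kappa>'_def)
              then have "\<kappa> v = c" using ec by (auto simp: \<tau>_def split: if_splits)
              then show False using q_unique[OF v x(1,2)] x(3) D(3) True by auto
            next
              case False
              then have "\<kappa> v = \<kappa> u" using ke \<open>v \<noteq> q\<close> by (simp add: \<kappa>'_def e_def)
              then show False using q_unique[OF v uC u(2)] u(1) False by auto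
            qed
          qed
          then have none: "{v \<in> C. adj q v \<and> \<kappa>' v = e} = {}" by blast
          show ?thesis unfolding cdeg_def none by simp
        qed
        moreover have "mono_edges B \<kappa>' = mono_edges C \<kappa>' + cdeg C \<kappa>' q e"
          using mono_edges_insert[OF fC qC, of \<kappa>'] by (simp add: B_def \<kappa>'_def)
        moreover have "\<mu> = mono_edges C \<kappa> + cdeg C \<kappa> q c"
          using mono_edges_insert[OF fC qC, of \<kappa>] by (simp add: B_def \<mu>_def c_def)
        moreover have "0 < cdeg C \<kappa> q c" using cdeg_pos[OF fC x(1,2), of \<kappa>] x(3) by simp
        ultimately show ?thesis using low[OF \<open>R \<kappa>'\<close>] by linarith
      qed
    qed
    have ym: "y1 \<in> B" "adj x y1" "\<kappa> y1 = c'" "y2 \<in> B" "adj x y2" "\<kappa> y2 = c'" using Y(2) by blast+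
    then have yC: "y1 \<in> C" "y2 \<in> C" using Yprop[OF ym(1-3)] Yprop[OF ym(4-6)] by simp_all
    \<comment> \<open>A neighbour of \<open>q\<close> among \<open>y1\<close>, \<open>y2\<close>
      must be \<open>x'\<close>; the other one would then separate \<open>x'\<close> from
      \<open>x\<close>, although these two are adjacent.\<close>
    have nadj: "\<not> adj q z" if yz: "y \<in> {y1, y2}" "z \<in> {y1, y2}" "y \<noteq> z" for y z
    proof
      assume qz: "adj q z"
      have z: "z \<in> C" "adj x z" "\<kappa> z = c'" and y: "y \<in> B" "y \<in> C" "adj x y" "\<kappa> y = c'"
        using yz ym yC by auto
      then have zx: "z = x'" using q_unique[OF z(1) qz x'(1,2)] x' by simp
      have "\<not> adj q y" using q_unique[OF y(2) _ z(1) qz] y z yz(3) by auto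
      then obtain K where K: "sep (C - {y}) K" "x' \<in> K" "x \<notin> K" using split y by blast
      moreover have "x \<in> C - {y}" using x y by auto
      ultimately show False using sepD[OF K(1,2), of x] z zx adj_sym by blast
    qed
    obtain K1 where K1: "sep (C - {y1}) K1" "x' \<in> K1" "x \<notin> K1" using split[of y1] ym nadj[of y2 y1] Y(1) by auto
    obtain K2 where K2: "sep (C - {y2}) K2" "x' \<in> K2" "x \<notin> K2" using split[of y2] ym nadj[of y1 y2] Y(1) by auto
    have xy: "x \<in> C - {y1}" "x \<in> C - {y2}" using x ym by auto
    have y2K1: "y2 \<notin> K1" using sepD[OF K1(1) _ xy(1), of y2] ym K1(3) adj_sym by blast
    have y1K2: "y1 \<notin> K2" using sepD[OF K2(1) _ xy(2), of y1] ym K2(3) adj_sym by blast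
    \<comment> \<open>An edge could leave the intersection only through \<open>y1\<close> or
      \<open>y2\<close>. Both are adjacent to \<open>x\<close>, so \<open>y2\<close> is not in
      \<open>K1\<close> and \<open>y1\<close> not in \<open>K2\<close>. The intersection contains
      \<open>x'\<close> but not \<open>x\<close>, against the connectivity of
      \<open>C\<close>.\<close>
    have "sep C (K1 \<inter> K2)"
      unfolding sep_def
    proof (intro conjI ballI notI)
      show "K1 \<inter> K2 \<subseteq> C" using K1(1) by (auto simp: sep_def)
      fix s t assume s: "s \<in> K1 \<inter> K2" and t: "t \<in> C - K1 \<inter> K2" and st: "adj s t"
      have "t \<noteq> y1" using sepD[OF K2(1), of s y1] s st yC Y(1) y1K2 by blast
      moreover have "t \<noteq> y2" using sepD[OF K1(1), of s y2] s st yC Y(1) y2K1 by blast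
      ultimately have "t \<in> K1" "t \<in> K2"
        using sepD[OF K1(1), of s t] sepD[OF K2(1), of s t] s t st by blast+
      then show False using t by blast
    qed
    then have "K1 \<inter> K2 = {} \<or> K1 \<inter> K2 = C" using connD[OF cC] by blast
    then show False using K1 K2 x(1) by blast
  qed
qed

section \<open>Combining colourings of pieces\<close>

lemma defective_permute:
  assumes "defective a V Z \<kappa>" "inj \<tau>" "\<And>i. i < a \<Longrightarrow> \<tau> i < a"
  shows "defective a V Z (\<lambda>v. \<tau> (\<kappa> v))"
proof -
  have "cdeg V (\<lambda>v. \<tau> (\<kappa> v)) v (\<tau> (\<kappa> v)) = cdeg V \<kappa> v (\<kappa> v)" for v
    unfolding cdeg_def using assms(2) by (simp add: inj_eq)
  then show ?thesis using assms(1,3) by (simp add: defective_def)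
qed

text \<open>Exchanging two colours throughout lets the colourings of two pieces agree at their
  common vertex.\<close>

lemma defective_recolour_vertex:
  assumes "defective a V Z \<kappa>" "p \<in> V" "c < a"
  obtains \<kappa>' where "defective a V Z \<kappa>'" "\<kappa>' p = c"
proof -
  define \<tau> where "\<tau> i = (if i = \<kappa> p then c else if i = c then \<kappa> p else i)" for i
  have "inj \<tau>" by (auto simp: inj_def \<tau>_def split: if_splits)
  moreover have "\<tau> i < a" if "i < a" for i
    using that assms by (simp add: \<tau>_def defective_def)
  ultimately have "defective a V Z (\<lambda>v. \<tau> (\<kappa> v))" using defective_permute[OF assms(1)] by blast
  then show thesis using that[of "\<lambda>v. \<tau> (\<kappa> v)"] by (simp add: \<tau>_def)
qed

text \<open>The condition on \<open>Z1 \<union> Z2\<close> lets \<open>p\<close> acquire a neighbour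
  of its colour from at most one side. If \<open>p\<close> is in \<open>T\<close>, it stays
  uncoloured and the two sides do not interact.\<close>

lemma defective_glue:
  assumes fV: "finite V" and p: "p \<in> V" and C: "sep (V - {p}) C" and T: "T \<subseteq> V - C"
    and g1: "defective a (V - C - T) Z1 \<kappa>1" and g2: "defective a (insert p C) Z2 \<kappa>2"
    and Z: "Z \<subseteq> Z1" "Z \<subseteq> Z2" "p \<in> Z1 \<union> Z2"
  shows "\<exists>\<kappa>. defective a (V - T) Z \<kappa>"
proof -
  have CV: "C \<subseteq> V" "p \<notin> C" using C by (auto simp: sep_def)
  have "\<exists>\<kappa>2'. defective a (insert p C) Z2 \<kappa>2' \<and> (p \<notin> T \<longrightarrow> \<kappa>2' p = \<kappa>1 p)"
  proof (cases "p \<in> T")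
    case True then show ?thesis using g2 by blast
  next
    case False
    then have "\<kappa>1 p < a" using g1 p CV by (simp add: defective_def)
    then show ?thesis using defective_recolour_vertex[OF g2, of p "\<kappa>1 p"] by blast
  qed
  then obtain \<kappa>2' where g2': "defective a (insert p C) Z2 \<kappa>2'" and eq: "p \<notin> T \<Longrightarrow> \<kappa>2' p = \<kappa>1 p"
    by blast
  define \<kappa> where "\<kappa> v = (if v \<in> C then \<kappa>2' v else \<kappa>1 v)" for v
  have fC: "finite C" using fV CV finite_subset by blast
  have bound: "cdeg (V - T) \<kappa> v (\<kappa> v) \<le> (if v \<in> Z then 0 else 1)" if v: "v \<in> V - T" for v
  proof -
    consider "v \<in> C" | "v = p" | "v \<notin> C" "v \<noteq> p" by blast
    then show ?thesis
    proof cases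
      case 1
      have "{u \<in> V - T. adj v u \<and> \<kappa> u = \<kappa> v} \<subseteq> {u \<in> insert p C. adj v u \<and> \<kappa>2' u = \<kappa>2' v}"
      proof
        fix u assume u: "u \<in> {u \<in> V - T. adj v u \<and> \<kappa> u = \<kappa> v}"
        then have "u \<in> insert p C" using sepD[OF C 1, of u] by blast
        then show "u \<in> {u \<in> insert p C. adj v u \<and> \<kappa>2' u = \<kappa>2' v}"
          using u 1 eq CV(2) by (auto simp: \<kappa>_def)
      qed
      then have "cdeg (V - T) \<kappa> v (\<kappa> v) \<le> cdeg (insert p C) \<kappa>2' v (\<kappa>2' v)"
        unfolding cdeg_def using fC by (intro card_mono) auto
      also have "\<dots> \<le> (if v \<in> Z2 then 0 else 1)" using g2' 1 by (simp add: defective_def)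
      also have "\<dots> \<le> (if v \<in> Z then 0 else 1)" using Z(2) by auto
      finally show ?thesis .
    next
      case 2
      then have pT: "p \<notin> T" using v by simp
      have "{u \<in> V - T. adj p u \<and> \<kappa> u = \<kappa> p} =
          {u \<in> V - C - T. adj p u \<and> \<kappa>1 u = \<kappa>1 p} \<union> {u \<in> insert p C. adj p u \<and> \<kappa>2' u = \<kappa>2' p}"
        using CV T eq[OF pT] by (auto simp: \<kappa>_def)
      then have "cdeg (V - T) \<kappa> p (\<kappa> p) \<le>
          cdeg (V - C - T) \<kappa>1 p (\<kappa>1 p) + cdeg (insert p C) \<kappa>2' p (\<kappa>2' p)"
        unfolding cdeg_def by (simp only: card_Un_le)
      also have "\<dots> \<le> (if p \<in> Z1 then 0 else 1) + (if p \<in> Z2 then 0 else 1)"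
        using g1 g2' p pT CV by (intro add_mono) (auto simp: defective_def)
      also have "\<dots> \<le> (if p \<in> Z then 0 else 1)" using Z by auto
      finally show ?thesis using 2 by simp
    next
      case 3
      have "{u \<in> V - T. adj v u \<and> \<kappa> u = \<kappa> v} \<subseteq> {u \<in> V - C - T. adj v u \<and> \<kappa>1 u = \<kappa>1 v}"
      proof
        fix u assume u: "u \<in> {u \<in> V - T. adj v u \<and> \<kappa> u = \<kappa> v}"
        have "u \<notin> C"
        proof
          assume "u \<in> C"
          moreover have "adj u v" using u adj_sym by blast
          ultimately show False using sepD[OF C, of u v] v 3 by blast
        qed
        then show "u \<in> {u \<in> V - C - T. adj v u \<and> \<kappa>1 u = \<kappa>1 v}"
          using u 3 by (simp add: \<kappa>_def)
      qed
      then have "cdeg (V - T) \<kappa> v (\<kappa> v) \<le> cdeg (V - C - T) \<kappa>1 v (\<kappa>1 v)"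
        unfolding cdeg_def using fV by (intro card_mono) auto
      also have "\<dots> \<le> (if v \<in> Z1 then 0 else 1)" using g1 v 3 by (simp add: defective_def)
      also have "\<dots> \<le> (if v \<in> Z then 0 else 1)" using Z(1) by auto
      finally show ?thesis .
    qed
  qed
  have "\<kappa> v < a" if "v \<in> V - T" for v
    using that g1 g2' by (simp add: \<kappa>_def defective_def)
  then have "defective a (V - T) Z \<kappa>" using bound by (simp add: defective_def)
  then show ?thesis by blast
qed

lemma defective_union:
  assumes A: "sep V A" and T: "T1 \<subseteq> A" "T2 \<subseteq> V - A"
    and g: "defective a (A - T1) Z \<kappa>1" "defective a (V - A - T2) Z \<kappa>2"
  shows "defective a (V - (T1 \<union> T2)) Z (\<lambda>v. if v \<in> A then \<kappa>1 v else \<kappa>2 v)"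
    (is "defective a ?W Z ?\<kappa>")
proof -
  have AV: "A \<subseteq> V" using A by (simp add: sep_def)
  have na: "\<not> adj u v" "\<not> adj v u" if "u \<in> A" "v \<in> V - A" for u v
    using A that adj_sym unfolding sep_def by blast+
  have "{u \<in> ?W. adj v u \<and> ?\<kappa> u = ?\<kappa> v} = {u \<in> A - T1. adj v u \<and> \<kappa>1 u = \<kappa>1 v}" if "v \<in> A" for v
    using that na(1)[of v] T AV by auto
  then have 1: "cdeg ?W ?\<kappa> v (?\<kappa> v) = cdeg (A - T1) \<kappa>1 v (\<kappa>1 v)" if "v \<in> A" for v
    using that by (simp add: cdeg_def)
  have "{u \<in> ?W. adj v u \<and> ?\<kappa> u = ?\<kappa> v} = {u \<in> V - A - T2. adj v u \<and> \<kappa>2 u = \<kappa>2 v}" if "v \<in> V - A" for v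
    using that na(2)[of _ v] T AV by auto
  then have 2: "cdeg ?W ?\<kappa> v (?\<kappa> v) = cdeg (V - A - T2) \<kappa>2 v (\<kappa>2 v)" if "v \<in> V - A" for v
    using that by (simp add: cdeg_def)
  show ?thesis
    unfolding defective_def
  proof
    fix v assume v: "v \<in> ?W"
    show "?\<kappa> v < a \<and> cdeg ?W ?\<kappa> v (?\<kappa> v) \<le> (if v \<in> Z then 0 else 1)"
    proof (cases "v \<in> A")
      case True
      then show ?thesis using 1[OF True] v g(1) by (simp add: defective_def)
    next
      case False
      then show ?thesis using 2[of v] v g(2) by (simp add: defective_def)
    qed
  qed
qed

text \<open>A vertex of \<open>T\<close> costs two; a vertex of \<open>S\<close> gains the drop of \<open>phi\<close> beyond \<open>2 * a - 2\<close>, and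
  a vertex of \<open>Z\<close>, which may have no neighbour of its own colour, gains an additional \<open>a\<close>. The bonus
  pays for a branch hanging at that vertex, which has been cut off.\<close>

definition solvable :: "nat \<Rightarrow> 'a set \<Rightarrow> 'a set \<Rightarrow> bool" where
  "solvable a V Z \<longleftrightarrow> (\<exists>S T \<kappa>. S \<subseteq> V \<and> T \<subseteq> V \<and> defective a (V - T) Z \<kappa> \<and>
     phi (V - S) + (2 * a - 2) * card S + 2 * card T \<le> phi V + a * card (S \<inter> Z))"

lemma solvable_defective: "defective a V Z \<kappa> \<Longrightarrow> solvable a V Z"
  unfolding solvable_def by (rule exI[of _ "{}"], rule exI[of _ "{}"]) auto

text \<open>Take \<open>C\<close> smallest among all nonempty proper closed sets of graphs
  \<open>V - {p}\<close>. If \<open>y\<close> in \<open>C\<close> were a cut vertex, a side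
  \<open>D\<close> of \<open>V - {y}\<close> without \<open>p\<close> would meet \<open>C\<close> in
  a smaller closed set, hence not at all. But neighbours of \<open>y\<close> other than
  \<open>p\<close> lie in \<open>C\<close>, so \<open>D\<close> would be closed in
  \<open>V\<close>.\<close>

lemma minimal_branch:
  assumes fV: "finite V" and cV: "conn V" and p0: "p0 \<in> V" "\<not> conn (V - {p0})" "V \<noteq> {p0}"
  obtains p C where "p \<in> V" "sep (V - {p}) C" "conn C" "\<And>y. y \<in> C \<Longrightarrow> conn (V - {y})"
proof -
  let ?P = "\<lambda>(p, C). p \<in> V \<and> sep (V - {p}) C \<and> C \<noteq> {} \<and> C \<noteq> V - {p}"
  have "\<exists>C. ?P (p0, C)" using p0 by (auto simp: conn_def)
  then obtain x where "?P x" and minx: "\<And>y. ?P y \<Longrightarrow> card (snd x) \<le> card (snd y)"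
    using ex_has_least_nat[of ?P _ "\<lambda>x. card (snd x)"] by blast
  obtain p C where x: "x = (p, C)" by (cases x)
  have p: "p \<in> V" and C: "sep (V - {p}) C" "C \<noteq> {}" "C \<noteq> V - {p}"
    using \<open>?P x\<close> by (auto simp: x)
  have min: "card C \<le> card D"
    if "q \<in> V" "sep (V - {q}) D" "D \<noteq> {}" "D \<noteq> V - {q}" for q D
    using minx[of "(q, D)"] that by (simp add: x)
  have CV: "C \<subseteq> V - {p}" using C(1) by (simp add: sep_def)
  then have fC: "finite C" using fV finite_subset by blast
  have "conn C"
    unfolding conn_def
  proof (intro conjI allI impI)
    fix X assume X: "sep C X"
    show "X = {} \<or> X = C"
    proof (rule ccontr)
      assume n: "\<not> ?thesis"
      have XC: "X \<subseteq> C" using X by (simp add: sep_def)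
      then have "card C \<le> card X" using min[OF p sep_trans[OF C(1) X]] n CV by blast
      then show False using card_seteq[OF fC XC] n by blast
    qed
  qed (use C in blast)
  moreover have "conn (V - {y})" if y: "y \<in> C" for y
    unfolding conn_def
  proof (intro conjI allI impI)
    show "V - {y} \<noteq> {}" using p y CV by blast
    have no: "D = {}" if D: "sep (V - {y}) D" "p \<notin> D" for D
    proof (rule ccontr)
      assume ne: "D \<noteq> {}"
      have DV: "D \<subseteq> V - {y}" using D(1) by (simp add: sep_def)
      have "sep (V - {y}) (D \<inter> C)"
        unfolding sep_def
      proof (intro conjI ballI notI)
        show "D \<inter> C \<subseteq> V - {y}" using DV by blast
        fix u v assume u: "u \<in> D \<inter> C" and v: "v \<in> V - {y} - D \<inter> C" and uv: "adj u v"
        have "v \<in> D" using sepD[OF D(1), of u v] u v uv by blast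
        moreover have "v \<in> C" using sepD[OF C(1), of u v] u v uv \<open>v \<in> D\<close> D(2) by blast
        ultimately show False using v by blast
      qed
      moreover have "D \<inter> C \<noteq> V - {y}" using p CV y by blast
      moreover have "card (D \<inter> C) < card C"
        using DV y fC by (intro psubset_card_mono) auto
      ultimately have empty: "D \<inter> C = {}" using min[of y "D \<inter> C"] y CV by force
      have "sep V D"
        unfolding sep_def
      proof (intro conjI ballI notI)
        show "D \<subseteq> V" using DV by blast
        fix u v assume u: "u \<in> D" and v: "v \<in> V - D" and uv: "adj u v"
        have "v = y" using sepD[OF D(1) u, of v] v uv by blast
        moreover have "u \<in> V - {p}" using u DV D(2) by blast
        ultimately have "u \<in> C" using sepD[OF C(1) y, of u] adj_sym[OF uv] by blast
        then show False using u empty by blast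
      qed
      then have "D = V" using connD[OF cV] ne by blast
      then show False using D(2) p by blast
    qed
    fix X assume X: "sep (V - {y}) X"
    show "X = {} \<or> X = V - {y}"
    proof (cases "p \<in> X")
      case True
      then have "V - {y} - X = {}" using no[OF sep_compl[OF X]] by blast
      then show ?thesis using X by (auto simp: sep_def)
    next
      case False
      then show ?thesis using no[OF X] by blast
    qed
  qed
  ultimately show thesis using that p C(1) by blast
qed

text \<open>The induction runs over all \<open>Z\<close> at once, because cutting off a branch at
  \<open>p\<close> may leave a smaller problem in which \<open>p\<close> has joined
  \<open>Z\<close>.\<close>

lemma solvable_all:
  assumes "finite V" and a: "2 \<le> a"
  shows "solvable a V Z"
  using assms(1)
proof (induction V arbitrary: Z rule: finite_psubset_induct)
  case (psubset V)
  note fV = psubset(1) and IH = psubset(2)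
  have fin: "finite A" if "A \<subseteq> V" for A
    using that fV finite_subset by blast
  \<comment> \<open>Makes the truncated difference \<open>2 * a - 2\<close> computable by
    simplification.\<close>
  obtain m where m: "a = Suc (Suc m)" using a by (metis add_2_eq_Suc le_Suc_ex)
  show ?case
  \<comment> \<open>Such a vertex goes into both \<open>S\<close> and \<open>T\<close>: it owes
    \<open>2 * a - 2\<close> for the first and 2 for the second, less the bonus \<open>a\<close> if
    it lies in \<open>Z\<close>.\<close>
  proof (cases "\<exists>v\<in>V. phi (V - {v}) + 2 * a \<le> phi V + (if v \<in> Z then a else 0)")
    case True
    then obtain v where v: "v \<in> V" "phi (V - {v}) + 2 * a \<le> phi V + (if v \<in> Z then a else 0)"
      by blast
    have "V - {v} \<subset> V" using v by blast
    then obtain S T \<kappa> where *: "S \<subseteq> V - {v}" "T \<subseteq> V - {v}" "defective a (V - {v} - T) Z \<kappa>"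
      "phi (V - {v} - S) + (2 * a - 2) * card S + 2 * card T \<le> phi (V - {v}) + a * card (S \<inter> Z)"
      using IH[of "V - {v}" Z] unfolding solvable_def by blast
    have f: "finite S" "finite T" using *(1,2) by (auto intro!: fin)
    have c: "card (insert v S) = Suc (card S)" "card (insert v T) = Suc (card T)"
      using *(1,2) f by (auto intro: card_insert_disjoint)
    have i: "card (insert v S \<inter> Z) = card (S \<inter> Z) + (if v \<in> Z then 1 else 0)"
    proof (cases "v \<in> Z")
      case True
      then have "insert v S \<inter> Z = insert v (S \<inter> Z)" by blast
      moreover have "v \<notin> S \<inter> Z" using *(1) by blast
      ultimately show ?thesis using True f by simp
    qed simp
    have "V - {v} - S = V - insert v S" "V - {v} - T = V - insert v T" by auto
    then have "phi (V - insert v S) + (2 * a - 2) * card (insert v S) + 2 * card (insert v T)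
        \<le> phi V + a * card (insert v S \<inter> Z)"
      using *(4) v(2) unfolding c i m by (cases "v \<in> Z") (simp_all add: algebra_simps)
    moreover have "defective a (V - insert v T) Z \<kappa>" using *(3) \<open>V - {v} - T = V - insert v T\<close> by simp
    ultimately show ?thesis
      using *(1,2) v(1) unfolding solvable_def
      by (intro exI[of _ "insert v S"] exI[of _ "insert v T"] exI[of _ \<kappa>]) blast
  next
    case False
    then have small: "phi V < phi (V - {v}) + (if v \<in> Z then a else 2 * a)" if "v \<in> V" for v
      using that by (auto split: if_splits)
    show ?thesis
    proof (cases "conn V")
      case ncV: False
      show ?thesis
      proof (cases "V = {}")
        case True
        then show ?thesis using solvable_defective[of a V Z] by (simp add: defective_def)
      next
        case False
        then obtain A where A: "sep V A" "A \<noteq> {}" "A \<noteq> V" using ncV by (auto simp: conn_def)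
        then have AV: "A \<subset> V" "V - A \<subset> V" by (auto simp: sep_def)
        obtain S T \<kappa> where 1: "S \<subseteq> A" "T \<subseteq> A" "defective a (A - T) Z \<kappa>"
          "phi (A - S) + (2 * a - 2) * card S + 2 * card T \<le> phi A + a * card (S \<inter> Z)"
          using IH[OF AV(1), of Z] unfolding solvable_def by blast
        obtain S' T' \<kappa>' where 2: "S' \<subseteq> V - A" "T' \<subseteq> V - A" "defective a (V - A - T') Z \<kappa>'"
          "phi (V - A - S') + (2 * a - 2) * card S' + 2 * card T' \<le> phi (V - A) + a * card (S' \<inter> Z)"
          using IH[OF AV(2), of Z] unfolding solvable_def by blast
        have f: "finite S" "finite T" "finite S'" "finite T'" using 1(1,2) 2(1,2) AV by (auto intro!: fin)
        have c: "card (S \<union> S') = card S + card S'" "card (T \<union> T') = card T + card T'"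
          "card ((S \<union> S') \<inter> Z) = card (S \<inter> Z) + card (S' \<inter> Z)"
        proof -
          show "card (S \<union> S') = card S + card S'" "card (T \<union> T') = card T + card T'"
            using 1(1,2) 2(1,2) f by (auto intro!: card_Un_disjoint)
          have "(S \<union> S') \<inter> Z = (S \<inter> Z) \<union> (S' \<inter> Z)" by blast
          moreover have "card ((S \<inter> Z) \<union> (S' \<inter> Z)) = card (S \<inter> Z) + card (S' \<inter> Z)"
            using 1(1) 2(1) f by (intro card_Un_disjoint) auto
          ultimately show "card ((S \<union> S') \<inter> Z) = card (S \<inter> Z) + card (S' \<inter> Z)" by simp
        qed
        have "sep (V - (S \<union> S')) (A - S)" using A(1) 2(1) unfolding sep_def by blast
        then have "phi (V - (S \<union> S')) = phi (A - S) + phi (V - (S \<union> S') - (A - S))"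
          using phi_sep fV by blast
        moreover have "V - (S \<union> S') - (A - S) = V - A - S'" using 1(1) AV(1) by blast
        ultimately have "phi (V - (S \<union> S')) = phi (A - S) + phi (V - A - S')" by simp
        then have "phi (V - (S \<union> S')) + (2 * a - 2) * card (S \<union> S') + 2 * card (T \<union> T')
            \<le> phi V + a * card ((S \<union> S') \<inter> Z)"
          using 1(4) 2(4) phi_sep[OF fV A(1)] unfolding c by (simp add: distrib_left)
        moreover note defective_union[OF A(1) 1(2) 2(2) 1(3) 2(3)]
        moreover have "S \<union> S' \<subseteq> V" "T \<union> T' \<subseteq> V" using 1(1,2) 2(1,2) AV by auto
        ultimately show ?thesis unfolding solvable_def by blast
      qed
    next
      case cV: True
      show ?thesis
      \<comment> \<open>Without cut vertices drops are degrees, so an optimal colouring already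
        works.\<close>
      proof (cases "\<exists>p0\<in>V. \<not> conn (V - {p0}) \<and> V \<noteq> {p0}")
        case False
        have "deg V v < (if v \<in> Z then a else 2 * a)" if v: "v \<in> V" for v
        proof (cases "V = {v}")
          case True
          then have none: "{u \<in> V. adj v u} = {}" by auto
          have "deg V v = 0" unfolding deg_def none by simp
          then show ?thesis using a by simp
        next
          case ne: False
          then have "conn (V - {v})" using False v by blast
          then show ?thesis using phi_remove_conn[OF fV cV v] small[OF v] by simp
        qed
        moreover obtain \<kappa> where "optimal a V \<kappa>" using optimal_exists[of a] a by auto
        ultimately have "defective a V Z \<kappa>" using optimal_defective fV by blast
        then show ?thesis by (rule solvable_defective)
      next
        case True
        then obtain p C where p: "p \<in> V" and C: "sep (V - {p}) C" "conn C"
          and nc: "\<And>y. y \<in> C \<Longrightarrow> conn (V - {y})"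
          using minimal_branch[OF fV cV] by blast
        have CV: "C \<subseteq> V" "p \<notin> C" and Cne: "C \<noteq> {}" using C by (auto simp: sep_def conn_def)
        have fC: "finite C" using CV fin by blast
        have "\<exists>u\<in>C. adj p u"
        proof (rule ccontr)
          assume n: "\<not> ?thesis"
          have "sep V C"
            unfolding sep_def
          proof (intro conjI ballI notI)
            fix u v assume u: "u \<in> C" and v: "v \<in> V - C" and uv: "adj u v"
            show False using sepD[OF C(1) u, of v] v uv n u adj_sym[OF uv] by blast
          qed (use CV in blast)
          then have "C = {} \<or> C = V" using connD[OF cV] by blast
          then show False using Cne CV p by blast
        qed
        note phiB = phi_insert_conn[OF fC C(2) CV(2) this]
        have rest: "insert p (V - {p} - C) = V - C" using p CV by blast
        have phiV: "phi V + 1 = phi C + deg C p + phi (V - C)"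
          using phi_cut_vertex[of "V - {p}" p C] fV C(1) p phiB by (simp add: rest insert_absorb)
        have degp: "deg C p < (if p \<in> Z then a else 2 * a)"
        proof -
          have "phi (V - {p}) = phi C + phi (V - {p} - C)" using phi_sep[OF _ C(1)] fV by simp
          moreover have "phi (V - {p} - C) + 1 \<le> phi (V - C)"
            using phi_insert_ge[of "V - {p} - C" p] fV by (simp add: rest)
          ultimately show ?thesis using small[OF p] phiV by linarith
        qed
        have degC: "deg (insert p C) v < (if v \<in> Z then a else 2 * a)" if v: "v \<in> C" for v
        proof -
          have "deg (insert p C) v \<le> deg V v" using fV CV p by (intro deg_mono) auto
          moreover have "phi V = phi (V - {v}) + deg V v"
            using phi_remove_conn[OF fV cV _ nc[OF v]] v CV by blast
          moreover have "phi V < phi (V - {v}) + (if v \<in> Z then a else 2 * a)"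
            using small v CV by blast
          ultimately show ?thesis by linarith
        qed
        \<comment> \<open>Deleting \<open>S\<close> lowers \<open>phi\<close> by the same amount in
          \<open>V\<close> as in \<open>V - C\<close>, except that deleting \<open>p\<close> also
          detaches \<open>C\<close>, which is worth another \<open>deg C p - 1\<close>.\<close>
        have deleted: "phi V + phi (V - C - S) =
            phi (V - S) + phi (V - C) + (if p \<in> S then deg C p - 1 else 0)" if S: "S \<subseteq> V - C" for S
        proof (cases "p \<in> S")
          case True
          have "sep (V - S) C" using C(1) S True unfolding sep_def by blast
          then have "phi (V - S) = phi C + phi (V - S - C)" using phi_sep fV by blast
          moreover have "V - S - C = V - C - S" by blast
          moreover have "deg C p > 0"
            using \<open>\<exists>u\<in>C. adj p u\<close> fC unfolding deg_def card_gt_0_iff by auto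
          ultimately show ?thesis using phiV True by simp
        next
          case False
          have "sep (V - S - {p}) C" using C(1) S unfolding sep_def by blast
          moreover have "insert p (V - S - {p}) = V - S" "insert p (V - S - {p} - C) = V - C - S"
            using p CV False by auto
          ultimately have "phi (V - S) + 1 = phi (insert p C) + phi (V - C - S)"
            using phi_cut_vertex[of "V - S - {p}" p C] fV by simp
          then show ?thesis using phiV phiB False by simp
        qed
        have sub: "V - C \<subset> V" using CV Cne by blast
        show ?thesis
        \<comment> \<open>If the branch can be coloured with \<open>p\<close> isolated, then
          \<open>p\<close> may have its neighbour of the same colour outside \<open>C\<close>, and
          the remainder is solved with \<open>Z\<close> unchanged.\<close>
        proof (cases "\<exists>\<kappa>. defective a (insert p C) (insert p Z) \<kappa>")
          case True
          then obtain \<kappa>2 where g2: "defective a (insert p C) (insert p Z) \<kappa>2" ..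
          obtain S T \<kappa> where 1: "S \<subseteq> V - C" "T \<subseteq> V - C" "defective a (V - C - T) Z \<kappa>"
            "phi (V - C - S) + (2 * a - 2) * card S + 2 * card T \<le> phi (V - C) + a * card (S \<inter> Z)"
            using IH[OF sub, of Z] unfolding solvable_def by blast
          obtain \<kappa>' where "defective a (V - T) Z \<kappa>'"
            using defective_glue[OF fV p C(1) 1(2,3) g2, of Z] by blast
          moreover have "phi (V - S) + (2 * a - 2) * card S + 2 * card T \<le> phi V + a * card (S \<inter> Z)"
            using 1(4) deleted[OF 1(1)] by linarith
          ultimately show ?thesis using 1(1,2) unfolding solvable_def by blast
        next
          case bad: False
          have opt: "defective a (insert p C) Y \<kappa>" if "optimal a (insert p C) \<kappa>"
            "\<And>v. v \<in> insert p C \<Longrightarrow> deg (insert p C) v < (if v \<in> Y then a else 2 * a)" for Y \<kappa>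
            using optimal_defective[OF _ that] fC by blast
          obtain \<kappa>0 where \<kappa>0: "optimal a (insert p C) \<kappa>0" using optimal_exists[of a] a by auto
          have dp: "a \<le> deg C p"
          proof (rule ccontr)
            assume "\<not> ?thesis"
            then have "deg (insert p C) v < (if v \<in> insert p Z then a else 2 * a)"
              if "v \<in> insert p C" for v
              using degC[of v] that by (cases "v = p") (simp_all add: deg_insert_self)
            then have "defective a (insert p C) (insert p Z) \<kappa>0" by (rule opt[OF \<kappa>0])
            then show False using bad by blast
          qed
          then have pZ: "p \<notin> Z" using degp by auto
          \<comment> \<open>Now \<open>p\<close> may need its one neighbour of the same colour
            inside \<open>C\<close>, so the remainder is solved with \<open>p\<close> added to
            \<open>Z\<close>.\<close>
          have g2: "defective a (insert p C) Z \<kappa>0"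
          proof (rule opt[OF \<kappa>0])
            fix v assume "v \<in> insert p C"
            then show "deg (insert p C) v < (if v \<in> Z then a else 2 * a)"
              using degC[of v] degp by (cases "v = p") (simp_all add: deg_insert_self)
          qed
          obtain S T \<kappa> where 1: "S \<subseteq> V - C" "T \<subseteq> V - C" "defective a (V - C - T) (insert p Z) \<kappa>"
            "phi (V - C - S) + (2 * a - 2) * card S + 2 * card T
              \<le> phi (V - C) + a * card (S \<inter> insert p Z)"
            using IH[OF sub, of "insert p Z"] unfolding solvable_def by blast
          obtain \<kappa>' where g: "defective a (V - T) Z \<kappa>'"
            using defective_glue[OF fV p C(1) 1(2,3) g2, of Z] by blast
          have fS: "finite S" using 1(1) fin by blast
          have SV: "S \<subseteq> V" "T \<subseteq> V" using 1(1,2) by auto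
          show ?thesis
          proof (cases "p \<in> S")
            case False
            then have "S \<inter> insert p Z = S \<inter> Z" by blast
            then have "phi (V - S) + (2 * a - 2) * card S + 2 * card T \<le> phi V + a * card (S \<inter> Z)"
              using 1(4) deleted[OF 1(1)] by simp
            then show ?thesis using SV g unfolding solvable_def by blast
          next
            case True
            then have "S \<inter> insert p Z = insert p (S \<inter> Z)" by blast
            then have cS: "card (S \<inter> insert p Z) = Suc (card (S \<inter> Z))" using pZ fS by simp
            show ?thesis
            proof (cases "deg C p = a")
              case False
              then have "phi (V - S) + (2 * a - 2) * card S + 2 * card T \<le> phi V + a * card (S \<inter> Z)"
                using 1(4) deleted[OF 1(1)] True dp unfolding cS by simp
              then show ?thesis using SV g unfolding solvable_def by blast
            next
              case da: True
              have nocut: "conn (insert p C - {v})" if v: "v \<in> C" for v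
                unfolding conn_def
              proof (intro conjI allI impI)
                have pv: "p \<in> insert p C - {v}" using v CV by auto
                then show "insert p C - {v} \<noteq> {}" by blast
                have no: "X = {}" if X: "sep (insert p C - {v}) X" "p \<notin> X" for X
                proof -
                  have XC: "X \<subseteq> C - {v}" using X unfolding sep_def by blast
                  have "sep (V - {v}) X"
                    unfolding sep_def
                  proof (intro conjI ballI notI)
                    show "X \<subseteq> V - {v}" using XC CV by blast
                    fix s t assume s: "s \<in> X" and t: "t \<in> V - {v} - X" and st: "adj s t"
                    have "t \<in> insert p C" using sepD[OF C(1), of s t] s t st XC by blast
                    then show False using sepD[OF X(1) s, of t] t st by blast
                  qed
                  then have "X = {} \<or> X = V - {v}" using connD[OF nc[OF v]] by blast
                  then show ?thesis using X(2) p v CV by blast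
                qed
                fix X assume X: "sep (insert p C - {v}) X"
                show "X = {} \<or> X = insert p C - {v}"
                proof (cases "p \<in> X")
                  case True
                  then have "insert p C - {v} - X = {}" using no[OF sep_compl[OF X]] by blast
                  then show ?thesis using X by (auto simp: sep_def)
                next
                  case False
                  then show ?thesis using no[OF X] by blast
                qed
              qed
              \<comment> \<open>This vertex supplies the missing unit: with \<open>p\<close>
                deleted, removing \<open>y\<close> lowers \<open>phi\<close> by
                \<open>2 * a - 1\<close>, while membership in \<open>S\<close> costs
                \<open>2 * a - 2\<close>. It is still coloured and does not enter
                \<open>T\<close>.\<close>
              obtain y where y: "y \<in> C" "y \<notin> Z" "deg C y = 2 * a - 1" "conn (C - {y})"
                using critical_branch[OF fC CV(2) C(2) a da degC nocut] bad by blast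
              have "V - insert y S - (C - {y}) = V - C - S" using y(1) CV by blast
              moreover have "sep (V - insert y S) (C - {y})"
                unfolding sep_def
              proof (intro conjI ballI notI)
                show "C - {y} \<subseteq> V - insert y S" using CV 1(1) by blast
                fix s t assume s: "s \<in> C - {y}" and t: "t \<in> V - insert y S - (C - {y})" and st: "adj s t"
                show False using sepD[OF C(1), of s t] s t st True by blast
              qed
              ultimately have "phi (V - insert y S) = phi (C - {y}) + phi (V - C - S)"
                using phi_sep[of "V - insert y S"] fV by simp
              moreover have "phi C = phi (C - {y}) + deg C y"
                using phi_remove_conn[OF fC C(2) y(1,4)] .
              moreover have "card (insert y S) = Suc (card S)"
                using y(1) 1(1) fS by (intro card_insert_disjoint) auto
              moreover have "insert y S \<inter> Z = S \<inter> Z" using y(2) by blast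
              ultimately have "phi (V - insert y S) + (2 * a - 2) * card (insert y S) + 2 * card T
                  \<le> phi V + a * card (insert y S \<inter> Z)"
                using 1(4) phiV y(3) da unfolding cS m by simp
              then show ?thesis
                using SV g y(1) CV unfolding solvable_def
                by (intro exI[of _ "insert y S"] exI[of _ T] exI[of _ \<kappa>']) blast
            qed
          qed
        qed
      qed
    qed
  qed
qed

text \<open>Passing to \<open>Suc a\<close> adds \<open>4 * card V\<close> on the left. The coloured
  vertices are paid for by the growth \<open>4 * (Suc a * D)\<close> of the constant, the uncoloured
  ones by the weight of \<open>T\<close> in \<open>solvable\<close>.\<close>

theorem phi_lower_bound:
  assumes "finite V" "diss_bounded V D" "1 \<le> a"
  shows "4 * a * card V \<le> 2 * phi V + D * (2 * a * a + 2 * a - 1)"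
  using assms(3,1,2)
proof (induction a arbitrary: V rule: dec_induct)
  case base
  obtain W where "W \<subseteq> V" "dissoc W" "4 * card V \<le> 2 * phi V + 3 * card W"
    using dissoc_two_thirds[OF base(1)] by blast
  moreover from this have "card W \<le> D" using base(2) by (simp add: diss_bounded_def)
  ultimately show ?case by simp
next
  case (step a)
  have fV: "finite V" and bV: "diss_bounded V D" using step.prems by auto
  obtain S T \<kappa> where *: "S \<subseteq> V" "T \<subseteq> V" "defective (Suc a) (V - T) {} \<kappa>"
    "phi (V - S) + (2 * Suc a - 2) * card S + 2 * card T \<le> phi V + Suc a * card (S \<inter> {})"
    using solvable_all[OF fV, of "Suc a" "{}"] step.hyps unfolding solvable_def by auto
  have "card (V - T) \<le> Suc a * D"
    using defective_card[OF _ *(3) diss_bounded_subset[OF bV]] fV by blast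
  then have T: "card V \<le> Suc a * D + card T"
    using card_Diff_subset[OF finite_subset[OF *(2) fV] *(2)] by linarith
  have "4 * a * card (V - S) \<le> 2 * phi (V - S) + D * (2 * a * a + 2 * a - 1)"
    using step.IH[of "V - S"] fV diss_bounded_subset[OF bV] by blast
  moreover have "4 * a * card (V - S) + 4 * a * card S = 4 * a * card V"
    using card_Diff_subset[OF finite_subset[OF *(1) fV] *(1)] card_mono[OF fV *(1)]
    by (metis add_mult_distrib2 le_add_diff_inverse2)
  \<comment> \<open>Doubling the inequality of \<open>solvable\<close> gives \<open>4 * a\<close>
    for each vertex of \<open>S\<close>, its share on the left, and 4 for each vertex of
    \<open>T\<close>.\<close>
  ultimately have "4 * a * card V + 4 * card T \<le> 2 * phi V + D * (2 * a * a + 2 * a - 1)"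
    using *(4) by simp
  then have "4 * a * card V + 4 * card V
      \<le> 2 * phi V + D * (2 * a * a + 2 * a - 1) + 4 * (Suc a * D)"
    using T by linarith
  moreover have eq: "2 * Suc a * Suc a + 2 * Suc a - 1 = (2 * a * a + 2 * a - 1) + 4 * Suc a"
    using step.hyps by (simp add: algebra_simps)
  have "D * (2 * Suc a * Suc a + 2 * Suc a - 1)
      = D * (2 * a * a + 2 * a - 1) + 4 * (Suc a * D)"
    unfolding eq by (simp add: distrib_left)
  moreover have "4 * Suc a * card V = 4 * a * card V + 4 * card V"
    by (simp add: distrib_right)
  ultimately show ?case by linarith
qed

end

section \<open>Bounds for graphs\<close>

lemma simple_graph_sgraph: "simple_graph G \<Longrightarrow> sgraph (edges G)"
  by unfold_locales (auto simp: simple_graph_def)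

lemma (in sgraph) degree_induced:
  assumes "edges G = E" "v \<in> S"
  shows "degree (induced G S) v = deg S v"
proof -
  have "{e \<in> {e \<in> E. e \<subseteq> S}. v \<in> e} = (\<lambda>u. {v, u}) ` {u \<in> S. adj v u}"
  proof
    show "{e \<in> {e \<in> E. e \<subseteq> S}. v \<in> e} \<subseteq> (\<lambda>u. {v, u}) ` {u \<in> S. adj v u}"
    proof
      fix e assume e: "e \<in> {e \<in> {e \<in> E. e \<subseteq> S}. v \<in> e}"
      then obtain x y where "e = {x, y}" using card_edge[of e] by (auto simp: card_2_iff)
      then obtain u where "e = {v, u}" using e by auto
      then show "e \<in> (\<lambda>u. {v, u}) ` {u \<in> S. adj v u}" using e by blast
    qed
  qed (use assms in auto)
  moreover have "card ((\<lambda>u. {v, u}) ` {u \<in> S. adj v u}) = card {u \<in> S. adj v u}"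
    by (rule card_image) (auto simp: inj_on_def doubleton_eq_iff)
  ultimately show ?thesis by (simp add: degree_def induced_def deg_def assms(1))
qed

lemma dissociation_set_iff:
  assumes "simple_graph G"
  shows "dissociation_set G S \<longleftrightarrow> S \<subseteq> verts G \<and> sgraph.dissoc (edges G) S"
proof -
  interpret sgraph "edges G" using assms by (rule simple_graph_sgraph)
  show ?thesis by (simp add: dissociation_set_def dissoc_def degree_induced)
qed

lemma dissociation_number_le_iff:
  assumes "simple_graph G"
  shows "dissociation_number G \<le> D \<longleftrightarrow> sgraph.diss_bounded (edges G) (verts G) D"
proof -
  interpret sgraph "edges G" using assms by (rule simple_graph_sgraph)
  have "finite {S. dissociation_set G S}"
    by (rule finite_subset[of _ "Pow (verts G)"])
      (use assms in \<open>auto simp: dissociation_set_def simple_graph_def\<close>)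
  moreover have "dissociation_set G {}" by (simp add: dissociation_set_def)
  ultimately have "dissociation_number G \<le> D \<longleftrightarrow> (\<forall>S. dissociation_set G S \<longrightarrow> card S \<le> D)"
    unfolding dissociation_number_def by (subst Max_le_iff) auto
  then show ?thesis using dissociation_set_iff[OF assms] by (auto simp: diss_bounded_def)
qed

lemma simple_graph_num:
  assumes "simple_graph G"
  shows "sgraph.edge_count (edges G) (verts G) = num_edges G"
proof -
  interpret sgraph "edges G" using assms by (rule simple_graph_sgraph)
  have "{e \<in> edges G. e \<subseteq> verts G} = edges G" using assms by (auto simp: simple_graph_def)
  then show ?thesis by (simp add: edge_count_def num_edges_def)
qed

lemma connected_graph_conn:
  assumes "simple_graph G" "connected_graph G"
  shows "sgraph.conn (edges G) (verts G)"
proof -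
  interpret sgraph "edges G" using assms(1) by (rule simple_graph_sgraph)
  have "v \<in> X" if X: "sep (verts G) X" and u: "u \<in> X" "v \<in> verts G" for u v X
  proof -
    have "u \<in> verts G" using X u by (auto simp: sep_def)
    then have "(u, v) \<in> {(x, y). {x, y} \<in> edges G}\<^sup>*"
      using assms(2) u(2) by (simp add: connected_graph_def)
    then show ?thesis
    proof (induction rule: rtrancl_induct)
      case base then show ?case using u by simp
    next
      case (step y z)
      then have yz: "{y, z} \<in> edges G" by simp
      then have "z \<in> verts G" using assms(1) by (auto simp: simple_graph_def)
      then show ?case using sepD[OF X step.IH _ yz] by simp
    qed
  qed
  then have "X = {} \<or> X = verts G" if "sep (verts G) X" for X
    using that unfolding sep_def by blast
  moreover have "verts G \<noteq> {}" using assms(2) by (simp add: connected_graph_def)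
  ultimately show ?thesis unfolding conn_def by blast
qed

lemma num_edges_lower_bound:
  assumes "simple_graph G" "dissociation_number G \<le> D"
  shows "2 * a * card (verts G) \<le> num_edges G + D * a * (a + 1)"
proof -
  interpret sgraph "edges G" using assms(1) by (rule simple_graph_sgraph)
  have "finite (verts G)" using assms(1) by (simp add: simple_graph_def)
  then show ?thesis
    using edge_count_lower_bound[of "verts G" D a] assms dissociation_number_le_iff simple_graph_num by metis
qed

lemma connected_num_edges_lower_bound:
  assumes "simple_graph G" "connected_graph G" "1 \<le> a"
  shows "4 * a * card (verts G)
    \<le> 2 * (num_edges G + 1) + dissociation_number G * (2 * a * a + 2 * a - 1)"
proof -
  interpret sgraph "edges G" using assms(1) by (rule simple_graph_sgraph)
  have "finite (verts G)" using assms(1) by (simp add: simple_graph_def)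
  moreover have "diss_bounded (verts G) (dissociation_number G)"
    using dissociation_number_le_iff[OF assms(1)] by blast
  moreover have "phi (verts G) = num_edges G + 1"
    using comps_conn[OF connected_graph_conn[OF assms(1,2)]] simple_graph_num[OF assms(1)]
    by (simp add: phi_def)
  ultimately show ?thesis using phi_lower_bound[of "verts G" _ a] assms(3) by metis
qed

section \<open>The family and the Turan number\<close>

lemma verts_CP [simp]: "verts (CP d) = {..<d}"
  by (simp add: CP_def)

text \<open>Valid for odd \<open>d\<close> as well: there the last vertex has its would-be partner
  outside \<open>{..<d}\<close>.\<close>

lemma CP_edge_iff:
  assumes "i < d" "j < d"
  shows "{i, j} \<in> edges (CP d) \<longleftrightarrow> i div 2 \<noteq> j div 2"
proof -
  have "card {i, j} = 2 \<longleftrightarrow> i \<noteq> j" by auto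
  moreover have "(\<exists>l. {i, j} = {2 * l, 2 * l + 1} \<and> l < d div 2) \<longleftrightarrow> i \<noteq> j \<and> i div 2 = j div 2"
  proof
    assume "i \<noteq> j \<and> i div 2 = j div 2"
    then have l: "i = 2 * (i div 2) \<and> j = 2 * (i div 2) + 1 \<or> j = 2 * (i div 2) \<and> i = 2 * (i div 2) + 1"
      by presburger
    then have "2 * (i div 2) + 1 < d" using assms by auto
    then have "i div 2 < d div 2" by linarith
    moreover have "{i, j} = {2 * (i div 2), 2 * (i div 2) + 1}" using l by (auto simp: doubleton_eq_iff)
    ultimately show "\<exists>l. {i, j} = {2 * l, 2 * l + 1} \<and> l < d div 2" by blast
  qed (auto simp: doubleton_eq_iff)
  ultimately show ?thesis
    using assms by (auto simp: CP_def complete_graph_def)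
qed

lemma edges_CP_subset: "e \<in> edges (CP d) \<Longrightarrow> e \<subseteq> {..<d} \<and> card e = 2"
  by (auto simp: CP_def complete_graph_def)

lemma edges_CP_eqI:
  assumes "\<And>e. e \<in> X \<Longrightarrow> e \<subseteq> {..<d} \<and> card e = 2"
    and "\<And>i j. i < d \<Longrightarrow> j < d \<Longrightarrow> i \<noteq> j \<Longrightarrow> {i, j} \<in> X \<longleftrightarrow> i div 2 \<noteq> j div 2"
  shows "X = edges (CP d)"
proof (rule set_eqI)
  fix e :: "nat set"
  show "e \<in> X \<longleftrightarrow> e \<in> edges (CP d)"
  proof (cases "e \<subseteq> {..<d} \<and> card e = 2")
    case True
    then obtain i j where "e = {i, j}" "i \<noteq> j" by (auto simp: card_2_iff)
    then show ?thesis using assms(2)[of i j] CP_edge_iff[of i d j] True by simp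
  next
    case False
    then show ?thesis using assms(1) edges_CP_subset by blast
  qed
qed

text \<open>For odd \<open>d\<close> the removed matching misses the vertex \<open>d - 1\<close>,
  which is therefore joined to all others. Both kinds of parts can thus be handled as
  \<open>CP\<close>.\<close>

lemma L_eq_CP:
  assumes "odd d"
  shows "L d = CP d"
proof -
  obtain m where d: "d = 2 * m + 1" using assms oddE by blast
  have no: "edges (complete_graph {2 * m}) = {}"
    by (auto simp: complete_graph_def card_2_iff)
  have "verts (L d) = verts (CP d)" by (auto simp: L_def join_def complete_graph_def d)
  moreover have "edges (L d) = edges (CP d)"
  proof (rule edges_CP_eqI)
    fix e assume "e \<in> edges (L d)"
    then have "e \<in> edges (CP (2 * m)) \<or> (\<exists>u<2 * m. e = {u, 2 * m})"
      using no by (auto simp: L_def join_def complete_graph_def d)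
    then show "e \<subseteq> {..<d} \<and> card e = 2"
    proof
      assume "e \<in> edges (CP (2 * m))"
      then show ?thesis using edges_CP_subset[of e "2 * m"] d by auto
    next
      assume "\<exists>u<2 * m. e = {u, 2 * m}"
      then show ?thesis using d by auto
    qed
  next
    fix i j assume ij: "i < d" "j < d" "i \<noteq> j"
    have eq: "{i, j} \<in> edges (L d) \<longleftrightarrow> {i, j} \<in> edges (CP (2 * m)) \<or> (\<exists>u<2 * m. {i, j} = {u, 2 * m})"
      using no by (auto simp: L_def join_def complete_graph_def d)
    consider "i < 2 * m" "j < 2 * m" | "i = 2 * m" "j < 2 * m" | "j = 2 * m" "i < 2 * m"
      using ij d by linarith
    then show "{i, j} \<in> edges (L d) \<longleftrightarrow> i div 2 \<noteq> j div 2"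
    proof cases
      case 1
      then show ?thesis using CP_edge_iff[OF 1] unfolding eq by (auto simp: doubleton_eq_iff)
    next
      case 2
      then have "{i, j} = {j, 2 * m}" by auto
      then show ?thesis using 2 unfolding eq by auto
    next
      case 3
      then show ?thesis unfolding eq by auto
    qed
  qed
  ultimately show ?thesis by (simp add: ugraph.expand)
qed

lemma card_edges_CP: "card (edges (CP d)) = (d choose 2) - d div 2"
proof -
  let ?M = "{{2 * i, 2 * i + 1} | i. i < d div 2}"
  have M: "?M = (\<lambda>i. {2 * i, 2 * i + 1}) ` {..<d div 2}" by auto
  have "card ?M = d div 2"
    unfolding M by (subst card_image) (auto simp: inj_on_def doubleton_eq_iff)
  moreover have "?M \<subseteq> {e. e \<subseteq> {..<d} \<and> card e = 2}" by auto
  moreover have "finite ?M" unfolding M by simp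
  ultimately show ?thesis
    using n_subsets[of "{..<d}" 2] by (simp add: CP_def complete_graph_def card_Diff_subset)
qed

text \<open>Both steps, from \<open>2 * a\<close> to \<open>2 * a + 1\<close> and on to
  \<open>2 * a + 2\<close>, add a vertex with \<open>2 * a\<close> neighbours: first one joined to
  everything, then its non-adjacent partner. This is the source of tightness.\<close>

lemma card_edges_CP_linear:
  assumes "2 * a \<le> d" "d \<le> 2 * a + 2"
  shows "card (edges (CP d)) + 2 * a * (a + 1) = 2 * a * d"
proof -
  consider "d = 2 * a" | "d = 2 * a + 1" | "d = 2 * a + 2" using assms by linarith
  then show ?thesis
  proof cases
    case 1
    then have "d choose 2 = a * (2 * a - 1)" by (simp add: choose_two)
    moreover have "a \<le> a * (2 * a - 1)" by (cases a) auto
    ultimately show ?thesis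
      unfolding card_edges_CP using 1 by (cases a) (simp_all add: algebra_simps)
  next
    case 2
    then have "d choose 2 = a * (2 * a + 1)" by (simp add: choose_two)
    then show ?thesis unfolding card_edges_CP using 2 by (simp add: algebra_simps)
  next
    case 3
    have "(2 * a + 2) * (2 * a + 1) = 2 * ((a + 1) * (2 * a + 1))" by simp
    then have "d choose 2 = (a + 1) * (2 * a + 1)"
      unfolding choose_two using 3 by simp
    then show ?thesis unfolding card_edges_CP using 3 by (simp add: algebra_simps)
  qed
qed

section \<open>Isomorphism and complements of matchings\<close>

lemma isomorphic_sym:
  assumes "isomorphic G H" "\<And>e. e \<in> edges G \<Longrightarrow> e \<subseteq> verts G"
  shows "isomorphic H G"
proof -
  obtain f where f: "bij_betw f (verts G) (verts H)" "edges H = (\<lambda>e. f ` e) ` edges G"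
    using assms(1) by (auto simp: isomorphic_def)
  let ?g = "inv_into (verts G) f"
  have "bij_betw ?g (verts H) (verts G)" using f(1) by (rule bij_betw_inv_into)
  moreover have "?g ` f ` e = e" if "e \<in> edges G" for e
    using inv_into_image_cancel[of f "verts G" e] f(1) assms(2)[OF that]
    by (simp add: bij_betw_def)
  then have "edges G = (\<lambda>e. ?g ` e) ` edges H"
    unfolding f(2) image_image by simp
  ultimately show ?thesis unfolding isomorphic_def by blast
qed

text \<open>Expresses that the complement is a matching: no vertex has two non-neighbours besides
  itself.\<close>

definition co_matching :: "'a ugraph \<Rightarrow> bool" where
  "co_matching G \<longleftrightarrow> (\<forall>v\<in>verts G. \<forall>u\<in>verts G. \<forall>w\<in>verts G.
     u \<noteq> v \<longrightarrow> w \<noteq> v \<longrightarrow> {u, v} \<notin> edges G \<longrightarrow> {w, v} \<notin> edges G \<longrightarrow> u = w)"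

lemma same_half_unique:
  fixes i j l :: nat
  assumes "i div 2 = l div 2" "j div 2 = l div 2" "i \<noteq> l" "j \<noteq> l"
  shows "i = j"
  using assms by linarith

lemma isomorphic_CP:
  assumes G: "simple_graph G" and iso: "isomorphic G (CP d)"
  shows "card (verts G) = d" "card (edges G) = card (edges (CP d))" "co_matching G"
proof -
  obtain f where f: "bij_betw f (verts G) {..<d}" and e: "edges (CP d) = (\<lambda>e. f ` e) ` edges G"
    using iso by (auto simp: isomorphic_def)
  have inj: "inj_on f (verts G)" using f by (simp add: bij_betw_def)
  have sub: "x \<subseteq> verts G" if "x \<in> edges G" for x using G that by (simp add: simple_graph_def)
  show "card (verts G) = d" using bij_betw_same_card[OF f] by simp
  have "inj_on (\<lambda>e. f ` e) (edges G)"
    using inj sub by (auto simp: inj_on_def inj_on_image_eq_iff[OF inj])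
  then show "card (edges G) = card (edges (CP d))" unfolding e by (simp add: card_image)
  have less: "f v < d" if "v \<in> verts G" for v using f that by (auto simp: bij_betw_def)
  have adj: "f u div 2 = f v div 2" if uv: "u \<in> verts G" "v \<in> verts G" "{u, v} \<notin> edges G" for u v
  proof (rule ccontr)
    assume "f u div 2 \<noteq> f v div 2"
    then have "{f u, f v} \<in> edges (CP d)" using CP_edge_iff less uv by blast
    then obtain x where x: "x \<in> edges G" "f ` x = f ` {u, v}" unfolding e by auto
    then have "x = {u, v}" using inj_on_image_eq_iff[OF inj sub[OF x(1)], of "{u, v}"] uv by simp
    then show False using x uv by simp
  qed
  show "co_matching G"
    unfolding co_matching_def
  proof (intro ballI impI)
    fix v u w
    assume *: "v \<in> verts G" "u \<in> verts G" "w \<in> verts G" "u \<noteq> v" "w \<noteq> v"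
      "{u, v} \<notin> edges G" "{w, v} \<notin> edges G"
    have "f u \<noteq> f v" "f w \<noteq> f v" using inj * by (auto simp: inj_on_def)
    moreover have "f u div 2 = f v div 2" "f w div 2 = f v div 2" using adj * by blast+
    ultimately have "f u = f w" using same_half_unique[of "f u" "f v" "f w"] by blast
    then show "u = w" using inj * by (auto simp: inj_on_def)
  qed
qed

lemma two_le_degree:
  assumes "u \<in> S" "w \<in> S" "u \<noteq> w" "{v, u} \<in> E" "{v, w} \<in> E" "finite S" "sgraph E"
  shows "2 \<le> sgraph.deg E S v"
proof -
  interpret sgraph E by fact
  have "card {u, w} \<le> deg S v" unfolding deg_def using assms by (intro card_mono) auto
  then show ?thesis using assms by simp
qed

text \<open>On three vertices a matching misses at least two of the three pairs, so in its
  complement one of these vertices has two neighbours among them.\<close>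

lemma dissociation_set_co_matching:
  assumes G: "simple_graph G" and C: "co_matching C" "edges C \<subseteq> edges G"
    and S: "dissociation_set G S"
  shows "card (S \<inter> verts C) \<le> 2"
proof (rule ccontr)
  interpret sgraph "edges G" using G by (rule simple_graph_sgraph)
  assume "\<not> ?thesis"
  then have "3 \<le> card (S \<inter> verts C)" by simp
  then obtain X where X: "X \<subseteq> S \<inter> verts C" "card X = 3"
    by (meson obtain_subset_with_card_n)
  then obtain u v w where uvw: "X = {u, v, w}" "u \<noteq> v" "u \<noteq> w" "v \<noteq> w"
    by (auto simp: card_Suc_eq numeral_3_eq_3)
  have dis: "dissoc S" "finite S"
    using S dissociation_set_iff[OF G] G by (auto simp: simple_graph_def intro: finite_subset)
  have no: False if "x \<in> X" "y \<in> X" "z \<in> X" "y \<noteq> z" "{x, y} \<in> edges C" "{x, z} \<in> edges C" for x y z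
  proof -
    have "2 \<le> deg S x"
      using two_le_degree[of y S z x "edges G"] that X C(2) dis(2) simple_graph_sgraph[OF G] by blast
    moreover have "deg S x \<le> 1" using dis(1) that(1) X by (auto simp: dissoc_def)
    ultimately show False by simp
  qed
  have co: "{x, y} \<in> edges C" if "x \<in> X" "y \<in> X" "z \<in> X" "{z, y} \<notin> edges C" "x \<noteq> y" "z \<noteq> y" "x \<noteq> z" for x y z
    using C(1) that X unfolding co_matching_def by blast
  have mem: "u \<in> X" "v \<in> X" "w \<in> X" using uvw by auto
  show False
  proof (cases "{u, v} \<in> edges C")
    case True
    show False
    proof (cases "{u, w} \<in> edges C")
      case True
      then show False using no[of u v w] \<open>{u, v} \<in> edges C\<close> mem uvw by blast
    next
      case False
      then have "{v, w} \<in> edges C" using co[of v w u] mem uvw by blast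
      then show False using no[of v u w] True mem uvw by (simp add: insert_commute)
    qed
  next
    case False
    then have "{w, v} \<in> edges C" using co[of w v u] mem uvw by blast
    moreover have "{w, u} \<in> edges C"
      using co[of w u v] False mem uvw by (simp add: insert_commute)
    ultimately show False using no[of w v u] mem uvw by blast
  qed
qed

lemma dissociation_number_union_le:
  assumes G: "simple_graph G" and C: "\<And>i. i < k \<Longrightarrow> co_matching (C i) \<and> edges (C i) \<subseteq> edges G"
    and V: "verts G = (\<Union>i<k. verts (C i))"
  shows "dissociation_number G \<le> 2 * k"
proof -
  interpret sgraph "edges G" using G by (rule simple_graph_sgraph)
  have "card S \<le> 2 * k" if S: "dissociation_set G S" for S
  proof -
    have "S = (\<Union>i<k. S \<inter> verts (C i))"
      using S V by (auto simp: dissociation_set_def)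
    then have "card S = card (\<Union>i<k. S \<inter> verts (C i))" by simp
    also have "\<dots> \<le> (\<Sum>i<k. card (S \<inter> verts (C i)))" by (rule card_UN_le) simp
    also have "\<dots> \<le> (\<Sum>i<k. 2)"
      by (rule sum_mono) (use dissociation_set_co_matching[OF G _ _ S] C in simp)
    finally show ?thesis by simp
  qed
  then show ?thesis
    using dissociation_number_le_iff[OF G] dissociation_set_iff[OF G] by (auto simp: diss_bounded_def)
qed

text \<open>Half of the smallest size works. If that size is \<open>2 * a + 1\<close>, a difference
  of two is excluded by parity, so no size exceeds \<open>2 * a + 2\<close>; if it is
  \<open>2 * a\<close>, a difference of two still fits.\<close>

lemma balanced_sizes:
  fixes ns :: "nat \<Rightarrow> nat"
  assumes k: "0 < k" and ge: "\<forall>i<k. 3 \<le> ns i"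
    and bal: "\<forall>i<k. \<forall>j<k. i \<noteq> j \<longrightarrow> \<bar>int (ns i) - int (ns j)\<bar> \<le> 2 \<and>
        (\<bar>int (ns i) - int (ns j)\<bar> = 2 \<longrightarrow> even (ns i) \<and> even (ns j))"
  obtains a where "1 \<le> a" "\<And>i. i < k \<Longrightarrow> 2 * a \<le> ns i \<and> ns i \<le> 2 * a + 2"
proof -
  obtain j where j: "j < k" and min: "\<And>i. i < k \<Longrightarrow> ns j \<le> ns i"
    using ex_has_least_nat[of "\<lambda>i. i < k" 0 ns] k by auto
  show thesis
  proof (rule that[of "ns j div 2"])
    have "3 \<le> ns j" using ge j by blast
    then show "1 \<le> ns j div 2" by linarith
    fix i assume i: "i < k"
    show "2 * (ns j div 2) \<le> ns i \<and> ns i \<le> 2 * (ns j div 2) + 2"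
    proof (cases "i = j")
      case False
      have b: "\<bar>int (ns i) - int (ns j)\<bar> \<le> 2" "\<bar>int (ns i) - int (ns j)\<bar> = 2 \<longrightarrow> even (ns j)"
        using bal i j False by blast+
      then show ?thesis using min[OF i] by presburger
    qed presburger
  qed
qed

lemma card_edges_union_le:
  assumes "\<And>i. i < k \<Longrightarrow> simple_graph (C i) \<and> isomorphic (C i) (CP (ns i))"
    and "\<And>i. i < k \<Longrightarrow> 2 * a \<le> ns i \<and> ns i \<le> 2 * a + 2"
  shows "card (\<Union>i<k. edges (C i)) + 2 * k * a * (a + 1) \<le> 2 * a * (\<Sum>i<k. ns i)"
proof -
  have "card (\<Union>i<k. edges (C i)) \<le> (\<Sum>i<k. card (edges (C i)))" by (rule card_UN_le) simp
  also have "\<dots> = (\<Sum>i<k. card (edges (CP (ns i))))"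
    by (rule sum.cong) (use isomorphic_CP(2) assms(1) in auto)
  finally have "card (\<Union>i<k. edges (C i)) + k * (2 * a * (a + 1))
      \<le> (\<Sum>i<k. card (edges (CP (ns i))) + 2 * a * (a + 1))"
    by (simp add: sum.distrib)
  also have "\<dots> = (\<Sum>i<k. 2 * a * ns i)"
    by (rule sum.cong) (use card_edges_CP_linear assms(2) in auto)
  also have "\<dots> = 2 * a * (\<Sum>i<k. ns i)" by (simp add: sum_distrib_left)
  also have "k * (2 * a * (a + 1)) = 2 * k * a * (a + 1)" by (simp only: mult_ac)
  finally show ?thesis .
qed

lemma T_family_bounds:
  assumes "G \<in> T_family n k" "0 < k"
  shows "simple_graph G" "connected_graph G" "card (verts G) = n" "dissociation_number G \<le> 2 * k"
    and "\<exists>a\<ge>1. num_edges G + 2 * k * a * (a + 1) \<le> 2 * a * n + (k - 1)"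
proof -
  obtain ns C F where *: "\<forall>i<k. 3 \<le> ns i" "(\<Sum>i<k. ns i) = n"
    "\<forall>i<k. \<forall>j<k. i \<noteq> j \<longrightarrow> \<bar>int (ns i) - int (ns j)\<bar> \<le> 2 \<and>
        (\<bar>int (ns i) - int (ns j)\<bar> = 2 \<longrightarrow> even (ns i) \<and> even (ns j))"
    "\<forall>i<k. simple_graph (C i) \<and> isomorphic (C i) (if even (ns i) then CP (ns i) else L (ns i))"
    "\<forall>i<k. \<forall>j<k. i \<noteq> j \<longrightarrow> verts (C i) \<inter> verts (C j) = {}"
    "card F = k - 1" "finite F"
    "\<forall>e\<in>F. \<exists>i<k. \<exists>j<k. i \<noteq> j \<and> (\<exists>u \<in> verts (C i). \<exists>v \<in> verts (C j). e = {u, v})"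
    "G = UGraph (\<Union>i<k. verts (C i)) ((\<Union>i<k. edges (C i)) \<union> F)" "connected_graph G"
    using assms(1) unfolding T_family_def by blast
  show "connected_graph G" by fact
  have sC: "simple_graph (C i)" and iC: "isomorphic (C i) (CP (ns i))" if "i < k" for i
    using *(4) that L_eq_CP[of "ns i"] by (auto split: if_splits)
  have fin: "finite (verts (C i))" if "i < k" for i using sC[OF that] by (simp add: simple_graph_def)
  have finE: "finite (edges (C i))" if "i < k" for i
    by (rule finite_subset[of _ "Pow (verts (C i))"]) (use sC[OF that] in \<open>auto simp: simple_graph_def\<close>)
  have Fe: "e \<subseteq> (\<Union>i<k. verts (C i)) \<and> card e = 2" if e: "e \<in> F" for e
  proof -
    obtain i j u v where ij: "i < k" "j < k" "i \<noteq> j" "u \<in> verts (C i)" "v \<in> verts (C j)" "e = {u, v}"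
      using bspec[OF *(8) e] by (elim exE conjE bexE) (rule that)
    then have "u \<noteq> v" using *(5) by blast
    then show ?thesis using ij by auto
  qed
  show sG: "simple_graph G"
    unfolding simple_graph_def
  proof (intro conjI ballI)
    show "finite (verts G)" using fin by (simp add: *(9))
    fix e assume "e \<in> edges G"
    then consider i where "i < k" "e \<in> edges (C i)" | "e \<in> F" by (auto simp: *(9))
    then have "e \<subseteq> verts G \<and> card e = 2"
    proof cases
      case 1
      then have "e \<subseteq> verts (C i) \<and> card e = 2" using sC by (simp add: simple_graph_def)
      then show ?thesis using 1(1) by (auto simp: *(9))
    next
      case 2
      then show ?thesis using Fe by (simp add: *(9))
    qed
    then show "e \<subseteq> verts G" "card e = 2" by auto
  qed
  have "card (verts G) = (\<Sum>i<k. card (verts (C i)))"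
    unfolding *(9) ugraph.sel using fin *(5) by (subst card_UN_disjoint) auto
  also have "\<dots> = (\<Sum>i<k. ns i)" by (rule sum.cong) (use isomorphic_CP(1)[OF sC iC] in auto)
  finally show "card (verts G) = n" using *(2) by simp
  show "dissociation_number G \<le> 2 * k"
    by (rule dissociation_number_union_le[OF sG, of k C])
      (use isomorphic_CP(3)[OF sC iC] in \<open>auto simp: *(9)\<close>)
  obtain a where a: "1 \<le> a" "\<And>i. i < k \<Longrightarrow> 2 * a \<le> ns i \<and> ns i \<le> 2 * a + 2"
    using balanced_sizes[OF assms(2) *(1,3)] by blast
  have "num_edges G \<le> card (\<Union>i<k. edges (C i)) + (k - 1)"
    unfolding num_edges_def *(9) ugraph.sel
    using card_Un_le[of "\<Union>i<k. edges (C i)" F] *(6) by linarith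
  then have "num_edges G + 2 * k * a * (a + 1) \<le> 2 * a * n + (k - 1)"
    using card_edges_union_le[of k C ns a] sC iC a(2) *(2) by simp
  then show "\<exists>a\<ge>1. num_edges G + 2 * k * a * (a + 1) \<le> 2 * a * n + (k - 1)" using a(1) by blast
qed

text \<open>For \<open>D = 2 * k\<close> the \<open>- 1\<close> in the factor of \<open>D\<close>
  yields \<open>k\<close> after halving, and the single component takes 1 back, hence
  \<open>k - 1\<close>.\<close>

lemma connected_lower_bound:
  assumes "simple_graph H" "connected_graph H" "card (verts H) = n" "dissociation_number H \<le> 2 * k"
    "1 \<le> a" "1 \<le> k"
  shows "2 * a * n + (k - 1) \<le> num_edges H + 2 * k * a * (a + 1)"
proof -
  let ?q = "2 * a * a + 2 * a - 1"
  have "4 * a * n \<le> 2 * (num_edges H + 1) + dissociation_number H * ?q"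
    using connected_num_edges_lower_bound[OF assms(1,2,5)] assms(3) by simp
  also have "dissociation_number H * ?q \<le> 2 * k * ?q" using assms(4) by (rule mult_le_mono1)
  finally have "4 * a * n \<le> 2 * (num_edges H + 1) + 2 * k * ?q" by simp
  moreover have "2 * k * ?q + 2 * k = 2 * (2 * k * a * (a + 1))"
  proof -
    have "?q + 1 = 2 * a * (a + 1)" using assms(5) by (simp add: algebra_simps)
    then have "2 * k * (?q + 1) = 2 * k * (2 * a * (a + 1))" by simp
    then show ?thesis by (simp add: algebra_simps)
  qed
  \<comment> \<open>The products are replaced by variables to leave a linear statement about natural
    numbers.\<close>
  moreover have "w + (k - 1) \<le> e + z" if "2 * w \<le> 2 * (e + 1) + y" "y + 2 * k = 2 * z" for w e y z
    using that assms(6) by presburger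
  from this[of "2 * a * n" _ "2 * k * ?q"] calculation show ?thesis by simp
qed

lemma T_family_dissociation_number:
  assumes "G \<in> T_family n k" "0 < k"
  shows "dissociation_number G = 2 * k"
proof (rule antisym)
  show "dissociation_number G \<le> 2 * k" using T_family_bounds[OF assms] by blast
  obtain a where a: "1 \<le> a" "num_edges G + 2 * k * a * (a + 1) \<le> 2 * a * n + (k - 1)"
    using T_family_bounds(5)[OF assms] by blast
  let ?q = "2 * a * a + 2 * a - 1"
  have 1: "2 * (2 * a * n) \<le> 2 * (num_edges G + 1) + dissociation_number G * ?q"
    using connected_num_edges_lower_bound[OF _ _ a(1), of G] T_family_bounds(1-3)[OF assms] by simp
  have 2: "2 * k * ?q + 2 * k = 2 * (2 * k * a * (a + 1))"
  proof -
    have "?q + 1 = 2 * a * (a + 1)" using a(1) by (simp add: algebra_simps)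
    then have "2 * k * (?q + 1) = 2 * k * (2 * a * (a + 1))" by simp
    then show ?thesis by (simp add: algebra_simps)
  qed
  have "y \<le> d" if "2 * w \<le> 2 * (e + 1) + d" "y + 2 * k = 2 * z" "e + z \<le> w + (k - 1)"
    for w e d y z
    using that assms(2) by presburger
  from this[OF 1 2 a(2)] have "2 * k * ?q \<le> dissociation_number G * ?q" .
  moreover have "0 < ?q" using a(1) by (simp add: algebra_simps)
  ultimately show "2 * k \<le> dissociation_number G" by simp
qed

section \<open>Complement graphs and the value of \<open>ex\<close>\<close>

definition compl_graph :: "nat \<Rightarrow> nat ugraph \<Rightarrow> nat ugraph" where
  "compl_graph n G = UGraph {..<n} (edges (complete_graph {..<n}) - edges G)"

lemma compl_graph:
  assumes "simple_graph G" "verts G = {..<n}"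
  shows "simple_graph (compl_graph n G)" "verts (compl_graph n G) = {..<n}"
    "num_edges (compl_graph n G) + num_edges G = n choose 2"
    "\<And>i j. i < n \<Longrightarrow> j < n \<Longrightarrow> i \<noteq> j \<Longrightarrow> {i, j} \<in> edges (compl_graph n G) \<longleftrightarrow> {i, j} \<notin> edges G"
proof -
  show "simple_graph (compl_graph n G)" "verts (compl_graph n G) = {..<n}"
    by (auto simp: simple_graph_def compl_graph_def complete_graph_def)
  show "{i, j} \<in> edges (compl_graph n G) \<longleftrightarrow> {i, j} \<notin> edges G" if "i < n" "j < n" "i \<noteq> j" for i j
    using that by (auto simp: compl_graph_def complete_graph_def)
  have sub: "edges G \<subseteq> {e. e \<subseteq> {..<n} \<and> card e = 2}"
    using assms by (auto simp: simple_graph_def)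
  have fin: "finite {e. e \<subseteq> {..<n} \<and> card e = (2::nat)}"
    by (rule finite_subset[of _ "Pow {..<n}"]) auto
  have "card {e. e \<subseteq> {..<n} \<and> card e = 2} = n choose 2" using n_subsets[of "{..<n}" 2] by simp
  then show "num_edges (compl_graph n G) + num_edges G = n choose 2"
    using card_Diff_subset[OF finite_subset[OF sub fin] sub] card_mono[OF fin sub]
    by (simp add: num_edges_def compl_graph_def complete_graph_def)
qed

text \<open>Peel off the two ends of an edge, or two arbitrary vertices once no edge is left;
  neither has a neighbour in the rest. Numbering each pair consecutively leaves one vertex at the
  end, as in \<open>L (2 * k + 1)\<close>.\<close>

lemma (in sgraph) dissoc_ordering:
  assumes "finite W" "dissoc W" "card W = 2 * k + 1"
  shows "\<exists>f. bij_betw f {..<2 * k + 1} W \<and>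
    (\<forall>i<2 * k + 1. \<forall>j<2 * k + 1. adj (f i) (f j) \<longrightarrow> i div 2 = j div 2)"
  using assms
proof (induction k arbitrary: W)
  case 0
  then obtain w where "W = {w}" by (auto simp: card_1_singleton_iff)
  then show ?case by (intro exI[of _ "\<lambda>_. w"]) (auto simp: bij_betw_def lessThan_Suc)
next
  case (Suc k)
  note fW = Suc.prems(1)
  have deg1: "x = y" if "v \<in> W" "x \<in> W" "y \<in> W" "adj v x" "adj v y" for v x y
  proof (rule ccontr)
    assume "x \<noteq> y"
    then have "2 \<le> deg W v" using two_le_degree[OF that(2,3) _ that(4,5) fW] sgraph_axioms by blast
    then show False using Suc.prems(2) that(1) by (auto simp: dissoc_def)
  qed
  have "\<exists>u\<in>W. \<exists>v\<in>W. u \<noteq> v \<and> (\<forall>w\<in>W - {u, v}. \<not> adj u w \<and> \<not> adj v w)"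
  proof (cases "\<exists>u\<in>W. \<exists>v\<in>W. adj u v")
    case True
    then obtain u v where uv: "u \<in> W" "v \<in> W" "adj u v" by blast
    then have "u \<noteq> v" by auto
    moreover have "\<not> adj u w \<and> \<not> adj v w" if "w \<in> W - {u, v}" for w
      using deg1[of u v w] deg1[of v u w] uv that adj_sym by blast
    ultimately show ?thesis using uv by blast
  next
    case False
    have "\<exists>u v. u \<in> W \<and> v \<in> W \<and> u \<noteq> v"
    proof (rule ccontr)
      assume "\<not> ?thesis"
      then have "card W \<le> 1" using card_le_Suc0_iff_eq[OF fW] by auto
      then show False using Suc.prems(3) by simp
    qed
    then show ?thesis using False by blast
  qed
  then obtain u v where uv: "u \<in> W" "v \<in> W" "u \<noteq> v"
    and sep: "\<And>w. w \<in> W - {u, v} \<Longrightarrow> \<not> adj u w \<and> \<not> adj v w" by blast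
  let ?W = "W - {u, v}"
  have "dissoc ?W"
    unfolding dissoc_def
  proof
    fix x assume x: "x \<in> ?W"
    have "deg ?W x \<le> deg W x" using fW by (intro deg_mono) auto
    then show "deg ?W x \<le> 1" using Suc.prems(2) x by (force simp: dissoc_def)
  qed
  moreover have "card ?W = 2 * k + 1" using uv fW Suc.prems(3) by simp
  ultimately obtain f where f: "bij_betw f {..<2 * k + 1} ?W"
    "\<And>i j. i < 2 * k + 1 \<Longrightarrow> j < 2 * k + 1 \<Longrightarrow> adj (f i) (f j) \<Longrightarrow> i div 2 = j div 2"
    using Suc.IH[of ?W] fW by blast
  define g where "g i = (if i = 0 then u else if i = 1 then v else f (i - 2))" for i
  have g0: "g 0 = u" "g 1 = v" "g (i + 2) = f i" for i by (auto simp: g_def)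
  have split: "{..<2 * Suc k + 1} = insert 0 (insert 1 ((\<lambda>i. i + 2) ` {..<2 * k + 1}))"
  proof
    show "{..<2 * Suc k + 1} \<subseteq> insert 0 (insert 1 ((\<lambda>i. i + 2) ` {..<2 * k + 1}))"
    proof
      fix i assume "i \<in> {..<2 * Suc k + 1}"
      then have "i = 0 \<or> i = 1 \<or> (i = (i - 2) + 2 \<and> i - 2 < 2 * k + 1)" by auto
      then show "i \<in> insert 0 (insert 1 ((\<lambda>i. i + 2) ` {..<2 * k + 1}))" by blast
    qed
  qed auto
  have "g ` {..<2 * Suc k + 1} = insert u (insert v (f ` {..<2 * k + 1}))"
    unfolding split image_insert image_image g0 by simp
  also have "\<dots> = W" using f(1) uv by (auto simp: bij_betw_def)
  finally have img: "g ` {..<2 * Suc k + 1} = W" .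
  then have "inj_on g {..<2 * Suc k + 1}"
    using Suc.prems(3) by (intro eq_card_imp_inj_on) auto
  with img have "bij_betw g {..<2 * Suc k + 1} W" by (simp add: bij_betw_def)
  moreover have "i div 2 = j div 2"
    if ij: "i < 2 * Suc k + 1" "j < 2 * Suc k + 1" "adj (g i) (g j)" for i j
  proof -
    have fW': "f i \<in> ?W" if "i < 2 * k + 1" for i using f(1) that by (auto simp: bij_betw_def)
    have cases: "i = 0 \<or> i = 1 \<or> (\<exists>i'<2 * k + 1. i = i' + 2)" if "i < 2 * Suc k + 1" for i
      using that split by blast
    have no: "\<not> adj (g i) (f j)" "\<not> adj (f j) (g i)" if "i = 0 \<or> i = 1" "j < 2 * k + 1" for i j
    proof -
      have "g i = u \<or> g i = v" using that(1) g0 by auto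
      then show "\<not> adj (g i) (f j)" using sep[OF fW'[OF that(2)]] by auto
      then show "\<not> adj (f j) (g i)" using adj_sym by blast
    qed
    consider "i = 0 \<or> i = 1" "j = 0 \<or> j = 1" | i' where "i = i' + 2" "i' < 2 * k + 1" "j = 0 \<or> j = 1"
      | j' where "i = 0 \<or> i = 1" "j = j' + 2" "j' < 2 * k + 1"
      | i' j' where "i = i' + 2" "i' < 2 * k + 1" "j = j' + 2" "j' < 2 * k + 1"
      using cases[OF ij(1)] cases[OF ij(2)] by blast
    then show ?thesis
    proof cases
      case 1
      then show ?thesis by auto
    next
      case 2
      then show ?thesis using no(2)[of j i'] ij(3) g0(3)[of i'] by simp
    next
      case 3
      then show ?thesis using no(1)[of i j'] ij(3) g0(3)[of j'] by simp
    next
      case 4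
      then show ?thesis using f(2)[of i' j'] ij(3) g0(3)[of i'] g0(3)[of j'] by simp
    qed
  qed
  ultimately show ?case by blast
qed

text \<open>In the ordering of \<open>2 * k + 1\<close> dissociated vertices only partners can be
  adjacent in the complement, so all other pairs are edges of \<open>G\<close> and form the
  copy.\<close>

lemma L_copy_of_dissociation:
  assumes G: "simple_graph G" "verts G = {..<n}" and D: "\<not> dissociation_number (compl_graph n G) \<le> 2 * k"
  shows "\<exists>H. subgraph H G \<and> isomorphic H (L (2 * k + 1))"
proof -
  let ?G = "compl_graph n G"
  note c = compl_graph[OF G]
  interpret sgraph "edges ?G" using c(1) by (rule simple_graph_sgraph)
  let ?d = "2 * k + 1"
  obtain W0 where W0: "W0 \<subseteq> {..<n}" "dissoc W0" "\<not> card W0 \<le> 2 * k"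
    using D dissociation_number_le_iff[OF c(1)] c(2) by (auto simp: diss_bounded_def)
  then obtain W where W: "W \<subseteq> W0" "card W = ?d"
    by (metis not_less_eq_eq obtain_subset_with_card_n Suc_eq_plus1)
  have fin: "finite W0" using finite_subset[OF W0(1)] by simp
  have fW: "finite W" using finite_subset[OF W(1) fin] .
  have "dissoc W"
    unfolding dissoc_def
  proof
    fix x assume x: "x \<in> W"
    have "deg W x \<le> deg W0 x" using fin W(1) by (rule deg_mono)
    then show "deg W x \<le> 1" using W0(2) W(1) x by (force simp: dissoc_def)
  qed
  then obtain f where f: "bij_betw f {..<?d} W"
    and adj: "\<And>i j. i < ?d \<Longrightarrow> j < ?d \<Longrightarrow> {f i, f j} \<in> edges ?G \<Longrightarrow> i div 2 = j div 2"
    using dissoc_ordering[OF fW _ W(2)] by blast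
  have inj: "inj_on f {..<?d}" and img: "f ` {..<?d} = W" using f by (auto simp: bij_betw_def)
  define H where "H = UGraph W ((\<lambda>e. f ` e) ` edges (CP ?d))"
  have E: "f ` e \<subseteq> W \<and> card (f ` e) = 2 \<and> f ` e \<in> edges G" if e: "e \<in> edges (CP ?d)" for e
  proof -
    have e2: "e \<subseteq> {..<?d}" "card e = 2" using edges_CP_subset[OF e] by auto
    then obtain i j where ij: "e = {i, j}" "i \<noteq> j" by (auto simp: card_2_iff)
    have l: "i < ?d" "j < ?d" using e2 ij by auto
    then have "i div 2 \<noteq> j div 2" using CP_edge_iff e ij by blast
    then have "{f i, f j} \<notin> edges ?G" using adj l by blast
    moreover have "f i \<noteq> f j" using inj l ij(2) by (auto simp: inj_on_def)
    moreover have "f i \<in> W" "f j \<in> W" using img l by auto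
    moreover from this have "f i < n" "f j < n" using W W0 by auto
    ultimately show ?thesis using c(4)[of "f i" "f j"] ij by auto
  qed
  have "subgraph H G"
    using E fW W(1) W0(1) G(2) by (auto simp: subgraph_def simple_graph_def H_def)
  moreover have "isomorphic (CP ?d) H"
    unfolding isomorphic_def using f by (auto simp: H_def)
  then have "isomorphic H (CP ?d)"
    by (rule isomorphic_sym) (use edges_CP_subset in \<open>simp only: verts_CP\<close>)
  then have "isomorphic H (L ?d)" using L_eq_CP[of ?d] by simp
  ultimately show ?thesis by blast
qed

text \<open>An edge of \<open>G\<close> inside the vertex set of the copy is a non-edge of the copy,
  and those form a matching.\<close>

lemma dissociation_of_L_copy:
  assumes G: "simple_graph G" "verts G = {..<n}"
    and H: "subgraph H (compl_graph n G)" "isomorphic H (L (2 * k + 1))"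
  shows "2 * k + 1 \<le> dissociation_number G"
proof -
  interpret sgraph "edges G" using G(1) by (rule simple_graph_sgraph)
  have sH: "simple_graph H" and VH: "verts H \<subseteq> {..<n}" and EH: "edges H \<subseteq> edges (compl_graph n G)"
    using H(1) compl_graph(2)[OF G] by (auto simp: subgraph_def)
  have iso: "isomorphic H (CP (2 * k + 1))" using H(2) L_eq_CP[of "2 * k + 1"] by simp
  note h = isomorphic_CP[OF sH iso]
  have nadj: "{u, v} \<notin> edges H" if "{u, v} \<in> edges G" for u v
    using EH that by (auto simp: compl_graph_def)
  have "dissoc (verts H)"
    unfolding dissoc_def
  proof
    fix v assume v: "v \<in> verts H"
    have "x = y" if "x \<in> {u \<in> verts H. adj v u}" "y \<in> {u \<in> verts H. adj v u}" for x y
    proof -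
      have "x \<noteq> v" "y \<noteq> v" using that by auto
      moreover have "{x, v} \<notin> edges H" "{y, v} \<notin> edges H" using that nadj adj_sym by blast+
      ultimately show ?thesis using h(3) v that unfolding co_matching_def by blast
    qed
    moreover have "finite {u \<in> verts H. adj v u}" using sH by (simp add: simple_graph_def)
    ultimately show "deg (verts H) v \<le> 1"
      unfolding deg_def using card_le_Suc0_iff_eq by (metis (no_types, lifting) One_nat_def)
  qed
  then have "card (verts H) \<le> dissociation_number G"
    using dissociation_number_le_iff[OF G(1)] VH G(2) by (auto simp: diss_bounded_def)
  then show ?thesis using h(1) by simp
qed

text \<open>The graph \<open>U\<close> serves as a certificate: its complement is free of the
  forbidden graph, and the complement of any other free graph obeys
  \<open>num_edges_lower_bound\<close>, so it has at least as many edges as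
  \<open>U\<close>.\<close>

lemma ex_L_value:
  assumes U: "simple_graph U" "verts U = {..<n}" "dissociation_number U \<le> 2 * k"
    and edge_count: "num_edges U + 2 * k * a * (a + 1) \<le> 2 * a * n"
  shows "ex n (L (2 * k + 1)) + num_edges U = n choose 2"
proof -
  let ?free = "\<lambda>G. \<not> (\<exists>H. subgraph H G \<and> isomorphic H (L (2 * k + 1)))"
  let ?S = "{G :: nat ugraph. simple_graph G \<and> verts G = {..<n} \<and> ?free G}"
  have "?S \<subseteq> UGraph {..<n} ` Pow (Pow {..<n})"
  proof
    fix G assume "G \<in> ?S"
    then have "G = UGraph {..<n} (edges G)" "edges G \<in> Pow (Pow {..<n})"
      by (auto simp: simple_graph_def ugraph.expand)
    then show "G \<in> UGraph {..<n} ` Pow (Pow {..<n})" by blast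
  qed
  then have "finite ?S" using finite_subset by blast
  note cU = compl_graph[OF U(1,2)]
  have "?free (compl_graph n U)" using dissociation_of_L_copy[OF U(1,2)] U(3) by fastforce
  then have mem: "compl_graph n U \<in> ?S" using cU by blast
  have le: "num_edges G \<le> num_edges (compl_graph n U)" if "G \<in> ?S" for G
  proof -
    have G: "simple_graph G" "verts G = {..<n}" "?free G" using that by auto
    note c = compl_graph[OF G(1,2)]
    have "dissociation_number (compl_graph n G) \<le> 2 * k" using L_copy_of_dissociation[OF G(1,2)] G(3) by blast
    then have "2 * a * n \<le> num_edges (compl_graph n G) + 2 * k * a * (a + 1)"
      using num_edges_lower_bound[OF c(1), of "2 * k" a] c(2) by simp
    then show ?thesis using edge_count c(3) cU(3) by linarith
  qed
  have "ex n (L (2 * k + 1)) = num_edges (compl_graph n U)"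
    unfolding ex_def by (rule Max_eqI) (use \<open>finite ?S\<close> le mem in auto)
  then show ?thesis using cU(3) by simp
qed

section \<open>A balanced member of the family\<close>

definition part_size :: "nat \<Rightarrow> nat \<Rightarrow> nat \<Rightarrow> nat" where
  "part_size n k i = n div k + (if i < n mod k then 1 else 0)"

text \<open>Vertex \<open>j\<close> of part \<open>i\<close> is \<open>i + k * j\<close>: the parts
  are the residue classes modulo \<open>k\<close>, and the numbers below \<open>k\<close> represent
  one part each, which makes linking easy.\<close>

definition part :: "nat \<Rightarrow> nat \<Rightarrow> nat \<Rightarrow> nat ugraph" where
  "part n k i = UGraph ((\<lambda>j. i + k * j) ` {..<part_size n k i})
     ((\<lambda>e. (\<lambda>j. i + k * j) ` e) ` edges (CP (part_size n k i)))"

lemma less_part_size_iff: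
  assumes "i < k"
  shows "j < part_size n k i \<longleftrightarrow> i + k * j < n"
proof -
  have n: "n = k * (n div k) + n mod k" by simp
  have m: "n mod k < k" using assms by simp
  consider "j < n div k" | "j = n div k" | "n div k < j" by linarith
  then show ?thesis
  proof cases
    case 1
    then have "k * (j + 1) \<le> k * (n div k)" by (intro mult_le_mono2) simp
    then have "k * j + k \<le> k * (n div k)" by simp
    then have "i + k * j < n" using n assms by linarith
    then show ?thesis using 1 by (simp add: part_size_def)
  next
    case 2
    have "i + k * j < n \<longleftrightarrow> i < n mod k" using n unfolding 2 by linarith
    then show ?thesis using 2 by (simp add: part_size_def)
  next
    case 3
    then have "k * (n div k + 1) \<le> k * j" by (intro mult_le_mono2) simp
    then have "k * (n div k) + k \<le> k * j" by simp
    then have "n < k * j" using n m by linarith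
    then show ?thesis using 3 by (simp add: part_size_def)
  qed
qed

lemma part_inj:
  fixes k :: nat
  shows "0 < k \<Longrightarrow> inj_on (\<lambda>j. i + k * j) A"
  by (auto simp: inj_on_def)

lemma verts_part: "i < k \<Longrightarrow> verts (part n k i) = {x. x < n \<and> x mod k = i}"
proof (rule set_eqI)
  fix x assume i: "i < k"
  show "x \<in> verts (part n k i) \<longleftrightarrow> x \<in> {x. x < n \<and> x mod k = i}"
  proof
    assume "x \<in> {x. x < n \<and> x mod k = i}"
    then have x: "x < n" "x = i + k * (x div k)" by auto
    then have "x div k < part_size n k i" using less_part_size_iff[OF i] by metis
    then show "x \<in> verts (part n k i)" using x(2) by (auto simp: part_def)
  qed (use i less_part_size_iff[OF i] in \<open>auto simp: part_def\<close>)
qed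

lemma part_CP:
  assumes "0 < k"
  shows "simple_graph (part n k i)" "isomorphic (part n k i) (CP (part_size n k i))"
proof -
  let ?f = "\<lambda>j. i + k * j" and ?d = "part_size n k i"
  have "?f ` e \<subseteq> verts (part n k i) \<and> card (?f ` e) = 2" if "e \<in> edges (CP ?d)" for e
  proof -
    have "e \<subseteq> {..<?d}" "card e = 2" using edges_CP_subset that by blast+
    then show ?thesis using card_image[OF part_inj[OF assms], of i e] by (auto simp: part_def)
  qed
  then show "simple_graph (part n k i)" by (auto simp: simple_graph_def part_def)
  have "isomorphic (CP ?d) (part n k i)"
    unfolding isomorphic_def using part_inj[OF assms]
    by (intro exI[of _ ?f]) (simp add: part_def bij_betw_def)
  then show "isomorphic (part n k i) (CP ?d)"
    by (rule isomorphic_sym) (use edges_CP_subset in \<open>simp only: verts_CP\<close>)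
qed

text \<open>For \<open>n \<ge> 3 * k\<close> its complement attains
  \<open>ex n (L (2 * k + 1))\<close>; adding a path through the representatives gives
  \<open>linked_parts\<close>.\<close>

definition parts :: "nat \<Rightarrow> nat \<Rightarrow> nat ugraph" where
  "parts n k = UGraph (\<Union>i<k. verts (part n k i)) (\<Union>i<k. edges (part n k i))"

definition linked_parts :: "nat \<Rightarrow> nat \<Rightarrow> nat ugraph" where
  "linked_parts n k = UGraph (\<Union>i<k. verts (part n k i))
     ((\<Union>i<k. edges (part n k i)) \<union> (\<lambda>i. {i, Suc i}) ` {..<k - 1})"

lemma Union_verts_part: "0 < k \<Longrightarrow> (\<Union>i<k. verts (part n k i)) = {..<n}"
  by (auto simp: verts_part)

lemma part_disjoint: "i < k \<Longrightarrow> j < k \<Longrightarrow> i \<noteq> j \<Longrightarrow> verts (part n k i) \<inter> verts (part n k j) = {}"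
  by (auto simp: verts_part)

lemma sum_part_size:
  assumes "0 < k"
  shows "(\<Sum>i<k. part_size n k i) = n"
proof -
  have "{..<k} \<inter> {i. i < n mod k} = {..<n mod k}" using assms by auto (meson less_trans mod_less_divisor)
  then show ?thesis
    by (simp add: part_size_def sum.distrib sum.If_cases)
qed

lemma part_size_ge: "0 < k \<Longrightarrow> 3 * k \<le> n \<Longrightarrow> 3 \<le> part_size n k i"
  using div_le_mono[of "3 * k" n k] by (simp add: part_size_def)

lemma connected_linked_parts:
  assumes k: "0 < k" and n: "3 * k \<le> n"
  shows "connected_graph (linked_parts n k)"
proof -
  let ?r = "{(x, y). {x, y} \<in> edges (linked_parts n k)}"
  have V: "verts (linked_parts n k) = {..<n}"
    using Union_verts_part[OF k] by (simp add: linked_parts_def)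
  have step: "({i + k * j, i + k * l} \<in> edges (linked_parts n k))"
    if "i < k" "i + k * j < n" "i + k * l < n" "j div 2 \<noteq> l div 2" for i j l
  proof -
    have "{j, l} \<in> edges (CP (part_size n k i))"
      using that less_part_size_iff[of i k] by (simp add: CP_edge_iff)
    then have "(\<lambda>j. i + k * j) ` {j, l} \<in> edges (part n k i)" unfolding part_def by (simp only: ugraph.sel) (rule imageI)
    then show ?thesis using that(1) by (auto simp: linked_parts_def)
  qed
  have first: "(0, i) \<in> ?r\<^sup>*" if "i < k" for i
    using that
  proof (induction i)
    case (Suc i)
    then have "{i, Suc i} \<in> edges (linked_parts n k)" by (auto simp: linked_parts_def)
    then show ?case using Suc by (auto intro: rtrancl_into_rtrancl)
  qed simp
  have reach: "(0, x) \<in> ?r\<^sup>*" if x: "x < n" for x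
  proof -
    define i j where "i = x mod k" and "j = x div k"
    have i: "i < k" and xi: "x = i + k * j" using k by (auto simp: i_def j_def)
    have i2: "i + k * 2 < n" using i n by linarith
    have "(i, x) \<in> ?r\<^sup>*"
    proof -
      \<comment> \<open>Vertex 0 of a part is adjacent to every vertex from 2 on; its non-neighbour,
        vertex 1, is reached through vertex 2, which exists because parts have at least three
        vertices.\<close>
      consider "j = 0" | "j = 1" | "2 \<le> j" by linarith
      then show ?thesis
      proof cases
        case 1
        then show ?thesis by (simp add: xi)
      next
        case 2
        have "(i, i + k * 2) \<in> ?r" using step[of i 0 2] i i2 by simp
        moreover have "(i + k * 2, x) \<in> ?r" using step[of i 2 1] i i2 x by (simp add: xi 2)
        ultimately show ?thesis by (meson converse_rtrancl_into_rtrancl r_into_rtrancl)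
      next
        case 3
        then have "(i, x) \<in> ?r" using step[of i 0 j] i i2 x by (simp add: xi)
        then show ?thesis by blast
      qed
    qed
    then show ?thesis using first[OF i] by (rule rtrancl_trans[rotated])
  qed
  have "sym ?r" by (auto simp: sym_def insert_commute)
  then have "sym (?r\<^sup>*)" by (rule sym_rtrancl)
  then have "(u, v) \<in> ?r\<^sup>*" if "u < n" "v < n" for u v
    using reach[OF that(1)] reach[OF that(2)] by (meson symD rtrancl_trans)
  moreover have "0 \<in> {..<n}" using n k by simp
  ultimately show ?thesis unfolding connected_graph_def V by blast
qed

lemma linked_parts_T_family:
  assumes k: "0 < k" and n: "3 * k \<le> n"
  shows "linked_parts n k \<in> T_family n k"
proof -
  let ?F = "(\<lambda>i. {i, Suc i}) ` {..<k - 1}"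
  have bal: "\<bar>int (part_size n k i) - int (part_size n k j)\<bar> \<le> 2"
    "\<bar>int (part_size n k i) - int (part_size n k j)\<bar> \<noteq> 2" for i j
    by (simp_all add: part_size_def)
  have iso: "isomorphic (part n k i)
      (if even (part_size n k i) then CP (part_size n k i) else L (part_size n k i))" for i
    using part_CP(2)[OF k] L_eq_CP by simp
  have "card ?F = k - 1" by (subst card_image) (auto simp: inj_on_def doubleton_eq_iff)
  moreover have "\<exists>i<k. \<exists>j<k. i \<noteq> j \<and> (\<exists>u\<in>verts (part n k i). \<exists>v\<in>verts (part n k j). e = {u, v})"
    if e: "e \<in> ?F" for e
  proof -
    obtain i where i: "i < k - 1" "e = {i, Suc i}" using e by auto
    then have "i \<in> verts (part n k i)" "Suc i \<in> verts (part n k (Suc i))"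
      using n by (auto simp: verts_part)
    then show ?thesis using i by (intro exI[of _ i] conjI exI[of _ "Suc i"] bexI) auto
  qed
  ultimately show ?thesis
    unfolding T_family_def mem_Collect_eq
    using bal iso part_CP(1)[OF k] part_disjoint sum_part_size[OF k] part_size_ge[OF assms]
      connected_linked_parts[OF assms]
    by (intro exI[of _ "part_size n k"] exI[of _ "part n k"] exI[of _ ?F])
      (auto simp: linked_parts_def)
qed

lemma parts_simple:
  assumes k: "0 < k"
  shows "simple_graph (parts n k)" "verts (parts n k) = {..<n}" "dissociation_number (parts n k) \<le> 2 * k"
proof -
  show V: "verts (parts n k) = {..<n}" using Union_verts_part[OF k] by (simp add: parts_def)
  show s: "simple_graph (parts n k)"
    unfolding simple_graph_def
  proof (intro conjI ballI)
    show "finite (verts (parts n k))" by (simp add: V)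
    fix e assume "e \<in> edges (parts n k)"
    then obtain i where i: "i < k" "e \<in> edges (part n k i)" by (auto simp: parts_def)
    then have "e \<subseteq> verts (part n k i) \<and> card e = 2"
      using part_CP(1)[OF k, of n i] by (simp add: simple_graph_def)
    then show "e \<subseteq> verts (parts n k)" "card e = 2" using i(1) by (auto simp: parts_def)
  qed
  show "dissociation_number (parts n k) \<le> 2 * k"
    by (rule dissociation_number_union_le[OF s, of k "part n k"])
      (use isomorphic_CP(3)[OF part_CP[OF k]] in \<open>auto simp: parts_def\<close>)
qed

text \<open>Two bounds meet: summing over the parts gives one inequality, and the lower bound for
  graphs with dissociation number at most \<open>2 * k\<close> gives the other.\<close>

lemma num_edges_parts:
  assumes k: "0 < k" and n: "3 * k \<le> n"
  obtains a where "1 \<le> a" "num_edges (parts n k) + 2 * k * a * (a + 1) = 2 * a * n"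
proof -
  let ?a = "n div k div 2"
  have a: "1 \<le> ?a" using div_le_mono[OF n, of k] k by simp
  have "2 * ?a \<le> part_size n k i \<and> part_size n k i \<le> 2 * ?a + 2" for i
    unfolding part_size_def by (simp split: if_splits) linarith
  then have "card (\<Union>i<k. edges (part n k i)) + 2 * k * ?a * (?a + 1) \<le> 2 * ?a * n"
    using card_edges_union_le[of k "part n k" "part_size n k" ?a] part_CP[OF k] sum_part_size[OF k]
    by simp
  moreover have "2 * ?a * n \<le> num_edges (parts n k) + 2 * k * ?a * (?a + 1)"
    using num_edges_lower_bound[of "parts n k" "2 * k" ?a] parts_simple[OF k, of n] by simp
  ultimately have "num_edges (parts n k) + 2 * k * ?a * (?a + 1) = 2 * ?a * n"
    by (simp add: num_edges_def parts_def)
  then show thesis using that a by blast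
qed

theorem theorem4p7:
  fixes k n :: nat
  assumes "k \<ge> 2" and "n \<ge> 3 * k"
  defines "m \<equiv> int (n choose 2) - int (ex n (L (2 * k + 1))) + int k - 1"
  shows "(\<forall>G \<in> (T_family n k :: 'a ugraph set).
            simple_graph G \<and> connected_graph G \<and> card (verts G) = n \<and>
            dissociation_number G = 2 * k \<and>
            (\<forall>H \<in> (connected_diss_graphs n (2 * k) :: 'b ugraph set). num_edges G \<le> num_edges H))
       \<and> (\<exists>H \<in> (connected_diss_graphs n (2 * k) :: nat ugraph set). int (num_edges H) = m)
       \<and> (\<forall>H \<in> (connected_diss_graphs n (2 * k) :: 'b ugraph set). m \<le> int (num_edges H))"
proof -
  have k: "0 < k" "1 \<le> k" using assms(1) by auto
  obtain a where a: "1 \<le> a" "num_edges (parts n k) + 2 * k * a * (a + 1) = 2 * a * n"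
    using num_edges_parts[OF k(1) assms(2)] .
  have "ex n (L (2 * k + 1)) + num_edges (parts n k) = n choose 2"
    by (rule ex_L_value[OF parts_simple[OF k(1)], of n a]) (use a(2) in simp)
  then have m: "m = int (num_edges (parts n k) + (k - 1))"
    using k(2) by (simp add: m_def of_nat_diff)
  have lower: "m \<le> int (num_edges H)" if "H \<in> connected_diss_graphs n (2 * k)" for H :: "'c ugraph"
    using connected_lower_bound[of H n k a] that a k(2) by (simp add: connected_diss_graphs_def m)
  have min: "num_edges G \<le> num_edges H"
    if GH: "G \<in> T_family n k" "H \<in> connected_diss_graphs n (2 * k)"
    for G :: "'a ugraph" and H :: "'b ugraph"
  proof -
    \<comment> \<open>The slope \<open>b\<close> belongs to the part sizes of \<open>G\<close>; the
      comparison with \<open>H\<close> uses the bound for this same \<open>b\<close>.\<close>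
    obtain b where "1 \<le> b" "num_edges G + 2 * k * b * (b + 1) \<le> 2 * b * n + (k - 1)"
      using T_family_bounds(5)[OF GH(1) k(1)] by blast
    then show ?thesis
      using connected_lower_bound[of H n k b] GH(2) k(2) by (simp add: connected_diss_graphs_def)
  qed
  have T: "linked_parts n k \<in> T_family n k" by (rule linked_parts_T_family[OF k(1) assms(2)])
  have H: "linked_parts n k \<in> connected_diss_graphs n (2 * k)"
    using T_family_bounds(1-3)[OF T k(1)] T_family_dissociation_number[OF T k(1)]
    by (simp add: connected_diss_graphs_def)
  \<comment> \<open>An upper bound is enough, since \<open>lower\<close> supplies the opposite
    inequality.\<close>
  have "num_edges (linked_parts n k) \<le> num_edges (parts n k) + (k - 1)"
  proof -
    have "card ((\<lambda>i. {i, Suc i}) ` {..<k - 1}) \<le> k - 1" using card_image_le[of "{..<k - 1}"] by simp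
    then show ?thesis
      using card_Un_le[of "\<Union>i<k. edges (part n k i)" "(\<lambda>i. {i, Suc i}) ` {..<k - 1}"]
      by (simp add: num_edges_def linked_parts_def parts_def)
  qed
  then have "int (num_edges (linked_parts n k)) = m" using lower[OF H] m by simp
  then have "\<exists>H \<in> (connected_diss_graphs n (2 * k) :: nat ugraph set). int (num_edges H) = m"
    using H by (rule bexI)
  moreover have "simple_graph G \<and> connected_graph G \<and> card (verts G) = n \<and>
      dissociation_number G = 2 * k" if G: "G \<in> T_family n k" for G :: "'a ugraph"
    using T_family_bounds(1-3)[OF G k(1)] T_family_dissociation_number[OF G k(1)] by simp
  moreover have "\<forall>H \<in> (connected_diss_graphs n (2 * k) :: 'b ugraph set). m \<le> int (num_edges H)"
    using lower by (intro ballI)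
  ultimately show ?thesis using min by simp
qed

end
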